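(* Let $\{x^k\}$ be a sequence generated by the penalty method described in the context (with parameter $p\ge 1$). Assume that $\{x^k\}_{k\in\mathcal{K}}$ converges to $x^\infty$ for some subsequence (infinite index set) $\mathcal{K}$. Then the following statements hold. (i) $x^\infty$ is a D-stationary point of the problem $$\min_{x\in X}\ \sum_{i=1}^I\left[\phi_i(x)+\zeta_i(x)-\psi_i(x)\right]_+^p .$$ (ii) If $x^\infty\in\Omega$ and $\mathcal{I}_=(x^\infty)=\emptyset$, then $x^\infty$ is a D-stationary point of the problem $\min_{x\in X}F(x)$. (iii) If $x^\infty\in\Omega$, $\mathcal{I}_=(x^\infty)\ne\emptyset$, and moreover the PSCQ holds for $\Omega$ at $x^\infty$, then $x^\infty$ is a B-stationary point of problem (P). (iv) If $x^\infty\in\Omega$, $\mathcal{I}_=(x^\infty)\neq\emptyset$, $X$ is a polyhedral set, and moreover, for every $i\in\mathcal{I}_=(x^\infty)$ and $j_i\in\mathcal{J}_i(x^\infty)$, $\phi_i$ and $\psi_{i,j_i}$ are affine and $\zeta_i$ is piecewise affine on $X$, then $x^\infty$ is a B-stationary point of problem (P).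
   Context: Problem. Consider the DC program $$\text{(P)}\qquad \min_{x\in X}\ F(x)=\phi_0(x)+\zeta_0(x)-\psi_0(x)\quad\text{s.t.}\quad \phi_i(x)+\zeta_i(x)-\psi_i(x)\le 0,\ i=1,\dots,I,$$ where $\psi_i(x)=\max_{1\le j\le J_i}\psi_{i,j}(x)$ for $i=0,1,\dots,I$ and some integers $J_i$; $X\subseteq\mathbb{R}^n$ is closed and convex; the $\zeta_i$ are convex and continuous on an open set $\mathcal{S}\supseteq X$; the $\phi_i$ and $\psi_{i,j}$ are convex and continuously differentiable on $\mathcal{S}$; and $\|\nabla\phi_i(x)-\nabla\phi_i(y)\|\le L_i\|x-y\|$ for all $x,y\in X$, with $L_i\ge 0$ ($i=0,\dots,I$). It is assumed that $L_0>0$, and for $i\in\{1,\dots,I\}$ one takes $L_i=0$ if $\phi_i$ is affine. Notation. $\|\cdot\|$ is the Euclidean norm; $[a]_+=\max\{a,0\}$, $[a]_+^p=([a]_+)^p$. $\mathcal{I}=\{1,\dots,I\}$, $\mathcal{J}_i=\{1,\dots,J_i\}$, $\mathcal{J}=\mathcal{J}_1\times\cdots\times\mathcal{J}_I$, with elements $\mathbf{j}=(j_1,\dots,j_I)$. $\Omega$ is the feasible region of (P). For $x\in X$: $\mathcal{J}_i(x)=\{j\in\mathcal{J}_i:\psi_i(x)=\psi_{i,j}(x)\}$ for $i=0,\dots,I$; $\mathcal{J}(x)=\mathcal{J}_1(x)\times\cdots\times\mathcal{J}_I(x)$; $\mathcal{I}_=(x)=\{i\in\mathcal{I}:\phi_i(x)+\zeta_i(x)-\psi_i(x)=0\}$.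 For $\epsilon>0$: $\mathcal{J}_{0,\epsilon}(x)=\{j\in\mathcal{J}_0:\psi_0(x)\le\psi_{0,j}(x)+\epsilon\}$ and $\mathcal{J}_\epsilon(x)=\{(j_1,\dots,j_I)\in\mathcal{J}:\psi_i(x)\le\psi_{i,j_i}(x)+\epsilon\ \forall i\in\mathcal{I}\}$. Tangent cone: for $x\in Y\subseteq\mathbb{R}^n$, $\mathcal{T}_Y(x)$ is the set of $d=\lim_k (x^k-x)/\tau_k$ for some $x^k\in Y$, $x^k\to x$, $\tau_k\downarrow 0$. Directional derivative: $f'(x;d)=\lim_{\tau\downarrow0}(f(x+\tau d)-f(x))/\tau$. Stationarity. $x\in Y$ is a B-stationary point of $f$ on $Y$ (of the problem $\min_{x\in Y}f(x)$) if $f'(x;d)\ge0$ for all $d\in\mathcal{T}_Y(x)$. If $Y$ is closed and convex, $x\in Y$ is a D-stationary point of $f$ on $Y$ if $f'(x;\bar x-x)\ge0$ for all $\bar x\in Y$. A B-stationary point of (P) is a B-stationary point of $F$ on $\Omega$. PSCQ. For $\bar x\in\Omega$ with $\mathcal{I}_=(\bar x)\neq\emptyset$, the pointwise Slater constraint qualification (PSCQ) holds for $\Omega$ at $\bar x$ if for every $\mathbf{j}=(j_1,\dots,j_I)\in\mathcal{J}(\bar x)$ there is $d_{\mathbf{j}}\in\mathcal{T}_X(\bar x)$ with $\nabla\phi_i(\bar x)^Td_{\mathbf{j}}+\zeta_i'(\bar x;d_{\mathbf{j}})-\nabla\psi_{i,j_i}(\bar x)^Td_{\mathbf{j}}<0$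 for all $i\in\mathcal{I}_=(\bar x)$. Model functions. For $\bar x\in X$: $\ell_f(x;\bar x)=f(\bar x)+\nabla f(\bar x)^T(x-\bar x)$ for smooth $f$; $\hat\phi_i(x;\bar x)=\phi_i(\bar x)+\nabla\phi_i(\bar x)^T(x-\bar x)+\tfrac{L_i}{2}\|x-\bar x\|^2$. For $p\ge1$, $\rho>0$, $j_0\in\mathcal{J}_0$, $\mathbf{j}=(j_1,\dots,j_I)\in\mathcal{J}$: $$F_\rho(x)=F(x)+\rho\sum_{i=1}^I[\phi_i(x)+\zeta_i(x)-\psi_i(x)]_+^p,$$ $$Q_\rho(x;\bar x,j_0,\mathbf{j})=\hat\phi_0(x;\bar x)+\zeta_0(x)-\ell_{\psi_{0,j_0}}(x;\bar x)+\rho\sum_{i=1}^I[\hat\phi_i(x;\bar x)+\zeta_i(x)-\ell_{\psi_{i,j_i}}(x;\bar x)]_+^p.$$ Penalty method. Input: $\epsilon>0$, $\rho_0>0$, $\sigma>1$, and a sequence $\{\eta_k\}$ of nonnegative reals with $\eta_k\to0$. For $k=0,1,2,\dots$: (1) find $x^k\in X$ such that $F_{\rho_k}(x^k)\le Q_{\rho_k}(x;x^k,j_0,\mathbf{j})+\eta_k$ for all $x\in X$, for every $j_0\in\mathcal{J}_{0,\epsilon}(x^k)$ and every $\mathbf{j}\in\mathcal{J}_\epsilon(x^k)$; (2) set $\rho_{k+1}=\sigma\rho_k$. *)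

theory Defs
  imports "HOL-Analysis.Analysis"
begin

section \<open>Calculus and variational notions\<close>

definition gradient :: "('a::euclidean_space \<Rightarrow> real) \<Rightarrow> 'a \<Rightarrow> 'a" where
  "gradient f x = (THE D. GDERIV f x :> D)"

definition C1_on :: "'a::euclidean_space set \<Rightarrow> ('a \<Rightarrow> real) \<Rightarrow> bool" where
  "C1_on S f \<longleftrightarrow> (\<forall>x\<in>S. f differentiable (at x)) \<and> continuous_on S (gradient f)"

definition has_dir_deriv :: "('a::euclidean_space \<Rightarrow> real) \<Rightarrow> 'a \<Rightarrow> 'a \<Rightarrow> real \<Rightarrow> bool" where
  "has_dir_deriv f x d D \<longleftrightarrow>
     ((\<lambda>t::real. (f (x + t *\<^sub>R d) - f x) / t) \<longlongrightarrow> D) (at_right 0)"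

text \<open>Only meaningful where the limit exists, as it does for a convex function at an
  interior point of its domain.\<close>
definition dir_deriv :: "('a::euclidean_space \<Rightarrow> real) \<Rightarrow> 'a \<Rightarrow> 'a \<Rightarrow> real" where
  "dir_deriv f x d = Lim (at_right (0::real)) (\<lambda>t. (f (x + t *\<^sub>R d) - f x) / t)"

definition tangent_cone :: "'a::euclidean_space set \<Rightarrow> 'a \<Rightarrow> 'a set" where
  "tangent_cone Y x =
     {d. \<exists>(u :: nat \<Rightarrow> 'a) (\<tau> :: nat \<Rightarrow> real).
           (\<forall>k. u k \<in> Y) \<and> u \<longlonglongrightarrow> x \<and> (\<forall>k. \<tau> k > 0) \<and> \<tau> \<longlonglongrightarrow> 0 \<and>
           (\<lambda>k. (u k - x) /\<^sub>R \<tau> k) \<longlonglongrightarrow> d}"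

text \<open>Both stationarity notions include the existence of the directional derivatives
  they mention.\<close>
definition B_stationary :: "('a::euclidean_space \<Rightarrow> real) \<Rightarrow> 'a set \<Rightarrow> 'a \<Rightarrow> bool" where
  "B_stationary f Y x \<longleftrightarrow>
     x \<in> Y \<and> (\<forall>d\<in>tangent_cone Y x. \<exists>D. has_dir_deriv f x d D \<and> D \<ge> 0)"

definition D_stationary :: "('a::euclidean_space \<Rightarrow> real) \<Rightarrow> 'a set \<Rightarrow> 'a \<Rightarrow> bool" where
  "D_stationary f Y x \<longleftrightarrow>
     x \<in> Y \<and> (\<forall>y\<in>Y. \<exists>D. has_dir_deriv f x (y - x) D \<and> D \<ge> 0)"

definition affine_fun_on :: "'a::euclidean_space set \<Rightarrow> ('a \<Rightarrow> real) \<Rightarrow> bool" where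
  "affine_fun_on Y f \<longleftrightarrow> (\<exists>a b. \<forall>x\<in>Y. f x = a \<bullet> x + b)"

definition piecewise_affine_on :: "'a::euclidean_space set \<Rightarrow> ('a \<Rightarrow> real) \<Rightarrow> bool" where
  "piecewise_affine_on Y f \<longleftrightarrow>
     (\<exists>\<P>. finite \<P> \<and> \<Union>\<P> = Y \<and> (\<forall>C\<in>\<P>. polyhedron C \<and> affine_fun_on C f))"

section \<open>DC programs\<close>

text \<open>Index 0 is the objective, indices \<open>1..ncon\<close> are the constraints; the pieces of the
  \<open>i\<close>-th maximum are numbered \<open>1..npieces i\<close>. The functions are total, but only their values
  on the open set \<open>dom\<close> are constrained; \<open>ground\<close> is the closed convex set that \<open>x\<close> ranges over.\<close>
record 'a dc_data =
  ground :: "'a set"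
  dom :: "'a set"
  ncon :: nat
  npieces :: "nat \<Rightarrow> nat"
  phi :: "nat \<Rightarrow> 'a \<Rightarrow> real"
  zeta :: "nat \<Rightarrow> 'a \<Rightarrow> real"
  psi :: "nat \<Rightarrow> nat \<Rightarrow> 'a \<Rightarrow> real"
  lip :: "nat \<Rightarrow> real"

definition dc_program :: "'a::euclidean_space dc_data \<Rightarrow> bool" where
  "dc_program P \<longleftrightarrow>
     closed (ground P) \<and> convex (ground P) \<and> open (dom P) \<and> ground P \<subseteq> dom P \<and>
     (\<forall>i\<le>ncon P.
        npieces P i \<ge> 1 \<and>
        convex_on (dom P) (zeta P i) \<and> continuous_on (dom P) (zeta P i) \<and>
        convex_on (dom P) (phi P i) \<and> C1_on (dom P) (phi P i) \<and>
        (\<forall>j\<in>{1..npieces P i}. convex_on (dom P) (psi P i j) \<and> C1_on (dom P) (psi P i j)) \<and>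
        lip P i \<ge> 0 \<and>
        (\<forall>x\<in>ground P. \<forall>y\<in>ground P.
           norm (gradient (phi P i) x - gradient (phi P i) y) \<le> lip P i * norm (x - y))) \<and>
     lip P 0 > 0 \<and>
     (\<forall>i\<in>{1..ncon P}. affine_fun_on (ground P) (phi P i) \<longrightarrow> lip P i = 0)"

definition psi_max :: "'a dc_data \<Rightarrow> nat \<Rightarrow> 'a \<Rightarrow> real" where
  "psi_max P i x = Max ((\<lambda>j. psi P i j x) ` {1..npieces P i})"

definition dc_fun :: "'a dc_data \<Rightarrow> nat \<Rightarrow> 'a \<Rightarrow> real" where
  "dc_fun P i x = phi P i x + zeta P i x - psi_max P i x"

definition feasible :: "'a dc_data \<Rightarrow> 'a set" where
  "feasible P = {x \<in> ground P. \<forall>i\<in>{1..ncon P}. dc_fun P i x \<le> 0}"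

definition active_constraints :: "'a dc_data \<Rightarrow> 'a \<Rightarrow> nat set" where
  "active_constraints P x = {i \<in> {1..ncon P}. dc_fun P i x = 0}"

definition active_pieces :: "'a dc_data \<Rightarrow> nat \<Rightarrow> 'a \<Rightarrow> nat set" where
  "active_pieces P i x = {j \<in> {1..npieces P i}. psi_max P i x = psi P i j x}"

definition eps_active_pieces :: "'a dc_data \<Rightarrow> real \<Rightarrow> nat \<Rightarrow> 'a \<Rightarrow> nat set" where
  "eps_active_pieces P \<epsilon> i x = {j \<in> {1..npieces P i}. psi_max P i x \<le> psi P i j x + \<epsilon>}"

text \<open>A tuple of piece indices, one per constraint, is an extensional function on
  \<open>{1..ncon P}\<close>.\<close>
definition active_tuples :: "'a dc_data \<Rightarrow> 'a \<Rightarrow> (nat \<Rightarrow> nat) set" where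
  "active_tuples P x = (\<Pi>\<^sub>E i\<in>{1..ncon P}. active_pieces P i x)"

definition eps_active_tuples :: "'a dc_data \<Rightarrow> real \<Rightarrow> 'a \<Rightarrow> (nat \<Rightarrow> nat) set" where
  "eps_active_tuples P \<epsilon> x = (\<Pi>\<^sub>E i\<in>{1..ncon P}. eps_active_pieces P \<epsilon> i x)"

definition PSCQ :: "'a::euclidean_space dc_data \<Rightarrow> 'a \<Rightarrow> bool" where
  "PSCQ P x \<longleftrightarrow>
     (\<forall>js\<in>active_tuples P x. \<exists>d\<in>tangent_cone (ground P) x. \<forall>i\<in>active_constraints P x.
        gradient (phi P i) x \<bullet> d + dir_deriv (zeta P i) x d
          - gradient (psi P i (js i)) x \<bullet> d < 0)"

section \<open>The penalty method\<close>

text \<open>\<open>max a 0 powr p\<close> is the \<open>p\<close>-th power of the positive part also for \<open>a \<le> 0\<close>, as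
  \<open>0 powr p = 0\<close>.\<close>
definition penalty_term :: "'a dc_data \<Rightarrow> real \<Rightarrow> 'a \<Rightarrow> real" where
  "penalty_term P p x = (\<Sum>i=1..ncon P. max (dc_fun P i x) 0 powr p)"

definition F_pen :: "'a dc_data \<Rightarrow> real \<Rightarrow> real \<Rightarrow> 'a \<Rightarrow> real" where
  "F_pen P p \<rho> x = dc_fun P 0 x + \<rho> * penalty_term P p x"

definition linearization :: "('a::euclidean_space \<Rightarrow> real) \<Rightarrow> 'a \<Rightarrow> 'a \<Rightarrow> real" where
  "linearization f xb x = f xb + gradient f xb \<bullet> (x - xb)"

definition phi_hat :: "'a::euclidean_space dc_data \<Rightarrow> nat \<Rightarrow> 'a \<Rightarrow> 'a \<Rightarrow> real" where
  "phi_hat P i xb x = linearization (phi P i) xb x + lip P i / 2 * (norm (x - xb))\<^sup>2"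

definition model :: "'a::euclidean_space dc_data \<Rightarrow> nat \<Rightarrow> nat \<Rightarrow> 'a \<Rightarrow> 'a \<Rightarrow> real" where
  "model P i j xb x = phi_hat P i xb x + zeta P i x - linearization (psi P i j) xb x"

definition Q_pen ::
    "'a::euclidean_space dc_data \<Rightarrow> real \<Rightarrow> real \<Rightarrow> 'a \<Rightarrow> nat \<Rightarrow> (nat \<Rightarrow> nat) \<Rightarrow> 'a \<Rightarrow> real" where
  "Q_pen P p \<rho> xb j0 js x =
     model P 0 j0 xb x + \<rho> * (\<Sum>i=1..ncon P. max (model P i (js i) xb x) 0 powr p)"

definition penalty_iterates ::
    "'a::euclidean_space dc_data \<Rightarrow> real \<Rightarrow> real \<Rightarrow> real \<Rightarrow> real \<Rightarrow> (nat \<Rightarrow> real) \<Rightarrow> (nat \<Rightarrow> 'a) \<Rightarrow> bool"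
  where
  "penalty_iterates P p \<epsilon> \<rho>\<^sub>0 \<sigma> \<eta> x \<longleftrightarrow>
     (\<exists>\<rho>. \<rho> 0 = \<rho>\<^sub>0 \<and> (\<forall>k. \<rho> (Suc k) = \<sigma> * \<rho> k) \<and>
        (\<forall>k. x k \<in> ground P \<and>
           (\<forall>j0\<in>eps_active_pieces P \<epsilon> 0 (x k). \<forall>js\<in>eps_active_tuples P \<epsilon> (x k). \<forall>y\<in>ground P.
              F_pen P p (\<rho> k) (x k) \<le> Q_pen P p (\<rho> k) (x k) j0 js y + \<eta> k)))"

end

theory Submission
  imports Defs
begin


text \<open>
  Along the convergent subsequence the penalty parameters tend to infinity and, because the
  \<open>\<epsilon>\<close>-active pieces at the iterates eventually include every piece active at the limit \<open>z\<close>,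
  each iterate is nearly optimal against the models \<open>Q\<close> built from every choice of pieces active
  at \<open>z\<close>. All four claims come from taking limits in this inequality; the locale
  \<open>penalty_limit\<close> records exactly what is used.

  Dividing by the penalty parameter first leaves only the penalties: \<open>z\<close> minimizes the
  model penalty built at \<open>z\<close> (\<open>penalty_le_model_penalty\<close>). In a fixed direction, the
  maximum of the pieces has the slope of its steepest active piece, so for that choice of pieces
  the model and the true constraint function agree to first order, and the powers of their
  positive parts do so as well (\<open>has_dir_deriv_pos_powr\<close>). Hence the penalty is D-stationary.

  Without dividing, a point \<open>y\<close> at which all model constraints built at late iterates hold has
  no model penalty, and the limit says that the objective at \<open>z\<close> is at most the value at \<open>y\<close> of
  the objective model (\<open>objective_le_model\<close>). If such points \<open>y\<close> occur on the whole initial part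
  of a ray from \<open>z\<close> in direction \<open>d\<close>, the objective has a nonnegative slope along \<open>d\<close>
  (\<open>objective_slope_nonneg_on_ray\<close>). It remains to supply rays.

  A constraint with negative value at \<open>z\<close> stays negative on a short ray, and so does an active one
  with a negative model slope; closing up over the cone of feasible directions gives
  \<open>objective_slope_nonneg_if_strict\<close>, which settles the case without active constraints. In
  general a direction tangent to the feasible set only has nonpositive slopes for the steepest
  pieces (\<open>tangent_cone_feasible_dir_model\<close>). Under the constraint qualification one tilts this
  direction slightly towards the Slater direction, which makes the slopes negative by convexity,
  and lets the tilt tend to zero. In the polyhedral case the active models do not depend on the
  base point and are affine on a short ray, so a nonpositive slope suffices as it stands.
\<close>

section \<open>Directional derivatives\<close>

lemma gradient_has_derivative:
  fixes f :: "'a::euclidean_space \<Rightarrow> real"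
  assumes "f differentiable (at x)"
  shows "(f has_derivative (\<lambda>h. gradient f x \<bullet> h)) (at x)"
proof -
  from assms obtain f' where f': "(f has_derivative f') (at x)"
    by (auto simp: differentiable_def)
  have "linear f'"
    using f' has_derivative_linear by blast
  then have "h \<bullet> adjoint f' 1 = f' h" for h
    by (simp add: adjoint_works)
  with f' have G: "GDERIV f x :> adjoint f' 1"
    by (simp add: gderiv_def)
  have "D = adjoint f' 1" if "GDERIV f x :> D" for D
    using has_derivative_unique[OF that[unfolded gderiv_def] G[unfolded gderiv_def]]
    by (metis vector_eq_ldot)
  with G have "GDERIV f x :> gradient f x"
    unfolding gradient_def by (rule theI)
  then show ?thesis
    by (simp add: gderiv_def inner_commute)
qed

text \<open>A Frechet derivative also gives the limit of difference quotients along directions that vary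
  with the step. This is what tangent directions require, since a tangent sequence is not a ray.\<close>
lemma has_derivative_difference_quotient:
  fixes f :: "'a::euclidean_space \<Rightarrow> real"
  assumes f: "(f has_derivative f') (at x)"
    and \<tau>: "(\<tau> \<longlongrightarrow> 0) F" and pos: "\<forall>\<^sub>F k in F. \<tau> k > 0" and v: "(v \<longlongrightarrow> d) F"
  shows "((\<lambda>k. (f (x + \<tau> k *\<^sub>R v k) - f x) / \<tau> k) \<longlongrightarrow> f' d) F"
proof -
  interpret f': bounded_linear f'
    using f by (rule has_derivative_bounded_linear)
  define g where "g y = norm (f y - f x - f' (y - x)) / norm (y - x)" for y
  have "(g \<longlongrightarrow> g x) (nhds x)"
    using f unfolding has_derivative_iff_norm tendsto_at_iff_tendsto_nhds[symmetric]
    by (simp add: g_def[abs_def])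
  then have "(g \<longlongrightarrow> 0) (nhds x)"
    by (simp add: g_def)
  moreover have "((\<lambda>k. x + \<tau> k *\<^sub>R v k) \<longlongrightarrow> x) F"
    using tendsto_add[OF tendsto_const[of x] tendsto_scaleR[OF \<tau> v]] by simp
  ultimately have "((\<lambda>k. g (x + \<tau> k *\<^sub>R v k)) \<longlongrightarrow> 0) F"
    by (rule filterlim_compose)
  then have "((\<lambda>k. g (x + \<tau> k *\<^sub>R v k) * norm (v k)) \<longlongrightarrow> 0) F"
    using tendsto_mult[OF _ tendsto_norm[OF v]] by fastforce
  moreover have "\<forall>\<^sub>F k in F. norm ((f (x + \<tau> k *\<^sub>R v k) - f x) / \<tau> k - f' (v k))
      \<le> g (x + \<tau> k *\<^sub>R v k) * norm (v k)"
    using pos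
  proof eventually_elim
    case (elim k)
    then show ?case
      by (auto simp: g_def f'.scaleR f'.zero divide_simps abs_mult algebra_simps)
  qed
  ultimately have "((\<lambda>k. (f (x + \<tau> k *\<^sub>R v k) - f x) / \<tau> k - f' (v k)) \<longlongrightarrow> 0) F"
    by (rule Lim_null_comparison[rotated])
  from tendsto_add[OF this f'.tendsto[OF v]] show ?thesis
    by simp
qed

lemma has_dir_deriv_unique:
  "has_dir_deriv f x d D \<Longrightarrow> has_dir_deriv f x d E \<Longrightarrow> D = E"
  unfolding has_dir_deriv_def using tendsto_unique trivial_limit_at_right_real by blast

lemma has_dir_deriv_eq: "has_dir_deriv f x d D \<Longrightarrow> dir_deriv f x d = D"
  unfolding has_dir_deriv_def dir_deriv_def by (rule tendsto_Lim) auto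

lemma has_dir_deriv_scale:
  assumes "has_dir_deriv f x d D" and "c \<ge> 0"
  shows "has_dir_deriv f x (c *\<^sub>R d) (c * D)"
proof (cases "c = 0")
  case False
  with assms(2) have "c > 0" by simp
  have "filterlim (\<lambda>t. c * t) (at_right 0) (at_right (0::real))"
  proof -
    have "((\<lambda>t. c * t) \<longlongrightarrow> 0) (at_right 0)"
      by (rule tendsto_eq_intros refl tendsto_ident_at)+ simp
    moreover have "\<forall>\<^sub>F t in at_right 0. c * t \<in> {0<..} \<and> c * t \<noteq> 0"
      using eventually_at_right_less[of "0::real"] by eventually_elim (use \<open>c > 0\<close> in auto)
    ultimately show ?thesis unfolding filterlim_at by (rule conjI[rotated])
  qed
  from tendsto_mult[OF tendsto_const[of c] filterlim_compose[OF assms(1)[unfolded has_dir_deriv_def] this]]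
  show ?thesis
    using \<open>c > 0\<close> by (simp add: has_dir_deriv_def mult.commute)
qed (simp add: has_dir_deriv_def)

lemma has_dir_deriv_tendsto:
  assumes "has_dir_deriv f x d D"
  shows "((\<lambda>t. f (x + t *\<^sub>R d)) \<longlongrightarrow> f x) (at_right 0)"
proof -
  have "((\<lambda>t. f x + t * ((f (x + t *\<^sub>R d) - f x) / t)) \<longlongrightarrow> f x + 0 * D) (at_right 0)"
    using assms unfolding has_dir_deriv_def
    by (intro tendsto_intros) auto
  then have "((\<lambda>t. f x + t * ((f (x + t *\<^sub>R d) - f x) / t)) \<longlongrightarrow> f x) (at_right 0)"
    by simp
  then show ?thesis
    by (rule Lim_transform_eventually)
       (use eventually_at_right_less[of "0::real"] in eventually_elim, simp)
qed

lemma has_dir_deriv_nonneg: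
  assumes "has_dir_deriv f x d D"
    and "\<forall>\<^sub>F t in at_right 0. f x \<le> f (x + t *\<^sub>R d)"
  shows "D \<ge> 0"
proof -
  have "\<forall>\<^sub>F t in at_right 0. 0 \<le> (f (x + t *\<^sub>R d) - f x) / t"
    using assms(2) eventually_at_right_less[of "0::real"] by eventually_elim auto
  with assms(1) show ?thesis
    unfolding has_dir_deriv_def by (intro tendsto_lowerbound) auto
qed

lemma has_dir_deriv_neg:
  assumes "has_dir_deriv f x d D" and "D < 0"
  shows "\<forall>\<^sub>F t in at_right 0. f (x + t *\<^sub>R d) < f x"
  using order_tendstoD(2)[OF assms[unfolded has_dir_deriv_def]] eventually_at_right_less[of "0::real"]
  by eventually_elim (auto simp: divide_less_0_iff)

lemma eventually_open_direction:
  fixes x d :: "'a::real_normed_vector"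
  assumes "open S" "x \<in> S"
  shows "\<forall>\<^sub>F t in at_right (0::real). x + t *\<^sub>R d \<in> S"
proof -
  have "((\<lambda>t. x + t *\<^sub>R d) \<longlongrightarrow> x + 0 *\<^sub>R d) (at_right 0)"
    by (intro tendsto_intros)
  then show ?thesis
    using assms topological_tendstoD by fastforce
qed

lemma has_dir_deriv_sum:
  assumes "\<And>i. i \<in> I \<Longrightarrow> has_dir_deriv (f i) x d (D i)"
  shows "has_dir_deriv (\<lambda>y. \<Sum>i\<in>I. f i y) x d (\<Sum>i\<in>I. D i)"
proof -
  have "((\<lambda>t. \<Sum>i\<in>I. (f i (x + t *\<^sub>R d) - f i x) / t) \<longlongrightarrow> (\<Sum>i\<in>I. D i)) (at_right 0)"
    using assms by (intro tendsto_sum) (simp add: has_dir_deriv_def)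
  then show ?thesis
    by (simp add: has_dir_deriv_def sum_subtractf flip: sum_divide_distrib)
qed

section \<open>Directional derivatives of convex functions\<close>

lemma convex_ray_mem:
  assumes "convex S" "x \<in> S" "x + s *\<^sub>R d \<in> S" "0 \<le> t" "t \<le> s"
  shows "x + t *\<^sub>R d \<in> S"
proof (cases "s = 0")
  case False
  with assms have "(1 - t/s) *\<^sub>R x + (t/s) *\<^sub>R (x + s *\<^sub>R d) \<in> S"
    by (intro convexD) auto
  also have "(1 - t/s) *\<^sub>R x + (t/s) *\<^sub>R (x + s *\<^sub>R d) = x + t *\<^sub>R d"
    using False by (simp add: algebra_simps)
  finally show ?thesis .
qed (use assms in auto)

lemma convex_eventually_ray_mem:
  assumes "convex S" "x \<in> S" "y \<in> S"
  shows "\<forall>\<^sub>F t in at_right 0. x + t *\<^sub>R (y - x) \<in> S"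
  using eventually_at_right_real[of 0 "1::real", OF zero_less_one]
  by eventually_elim (use assms in \<open>auto intro: convex_ray_mem[of S x 1]\<close>)

lemma convex_on_slope_bounds:
  fixes x d :: "'a::real_vector"
  assumes f: "convex_on S f" and t: "0 < t"
  shows convex_on_slope_mono:
      "\<lbrakk>x \<in> S; x + t *\<^sub>R d \<in> S; 0 < s; s \<le> t\<rbrakk>
        \<Longrightarrow> (f (x + s *\<^sub>R d) - f x) / s \<le> (f (x + t *\<^sub>R d) - f x) / t"
    and convex_on_slope_ge:
      "\<lbrakk>x - s *\<^sub>R d \<in> S; x + t *\<^sub>R d \<in> S; 0 < s\<rbrakk>
        \<Longrightarrow> (f x - f (x - s *\<^sub>R d)) / s \<le> (f (x + t *\<^sub>R d) - f x) / t"
proof -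
  assume *: "x \<in> S" "x + t *\<^sub>R d \<in> S" "0 < s" "s \<le> t"
  have "f ((1 - s/t) *\<^sub>R x + (s/t) *\<^sub>R (x + t *\<^sub>R d)) \<le> (1 - s/t) * f x + (s/t) * f (x + t *\<^sub>R d)"
    using f * t by (intro convex_onD) auto
  also have "(1 - s/t) *\<^sub>R x + (s/t) *\<^sub>R (x + t *\<^sub>R d) = x + s *\<^sub>R d"
    using t by (simp add: algebra_simps)
  finally show "(f (x + s *\<^sub>R d) - f x) / s \<le> (f (x + t *\<^sub>R d) - f x) / t"
    using t * by (simp add: field_simps)
next
  assume *: "x - s *\<^sub>R d \<in> S" "x + t *\<^sub>R d \<in> S" "0 < s"
  \<comment> \<open>\<open>l\<close> is the weight that puts \<open>x\<close> between the two points.\<close>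
  define l where "l = s / (s + t)"
  have l: "0 \<le> l" "l \<le> 1" "l * (s + t) = s"
    using t * by (auto simp: l_def)
  have "f ((1 - l) *\<^sub>R (x - s *\<^sub>R d) + l *\<^sub>R (x + t *\<^sub>R d))
      \<le> (1 - l) * f (x - s *\<^sub>R d) + l * f (x + t *\<^sub>R d)"
    using f * l by (intro convex_onD) auto
  also have "(1 - l) *\<^sub>R (x - s *\<^sub>R d) + l *\<^sub>R (x + t *\<^sub>R d) = x + (l * (s + t) - s) *\<^sub>R d"
    by (simp add: algebra_simps)
  finally have "(s + t) * f x \<le> (s + t) * ((1 - l) * f (x - s *\<^sub>R d) + l * f (x + t *\<^sub>R d))"
    using l t * by (intro mult_left_mono) auto
  also have "\<dots> = (s + t - l * (s + t)) * f (x - s *\<^sub>R d) + (l * (s + t)) * f (x + t *\<^sub>R d)"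
    by (simp add: algebra_simps)
  finally show "(f x - f (x - s *\<^sub>R d)) / s \<le> (f (x + t *\<^sub>R d) - f x) / t"
    using t * l by (simp add: field_simps)
qed

text \<open>The slopes of a convex function increase with the step, and they are bounded below by a slope
  taken in the opposite direction, which exists because the domain is open.\<close>
lemma convex_has_dir_deriv:
  fixes f :: "'a::euclidean_space \<Rightarrow> real"
  assumes f: "convex_on S f" and S: "open S" "x \<in> S"
  shows "has_dir_deriv f x d (dir_deriv f x d)"
proof -
  define q where "q t = (f (x + t *\<^sub>R d) - f x) / t" for t
  have "\<forall>\<^sub>F t in at_right (0::real). x + t *\<^sub>R d \<in> S \<and> x - t *\<^sub>R d \<in> S \<and> 0 < t"
    using eventually_open_direction[OF S, of d] eventually_open_direction[OF S, of "- d"]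
      eventually_at_right_less[of "0::real"] by eventually_elim simp
  then obtain \<delta> where \<delta>: "x + \<delta> *\<^sub>R d \<in> S" "x - \<delta> *\<^sub>R d \<in> S" "0 < \<delta>"
    using eventually_happens' trivial_limit_at_right_real by blast
  have in_S: "x + t *\<^sub>R d \<in> S" if "0 < t" "t \<le> \<delta>" for t
    using convex_ray_mem[OF convex_on_imp_convex[OF f] S(2) \<delta>(1)] that by simp
  have mono: "q s \<le> q t" if "0 < s" "s \<le> t" "t \<le> \<delta>" for s t
    unfolding q_def using that in_S[of t] f S by (intro convex_on_slope_mono) auto
  have ge: "(f x - f (x - \<delta> *\<^sub>R d)) / \<delta> \<le> q t" if "0 < t" "t \<le> \<delta>" for t
    unfolding q_def using that in_S[of t] f \<delta> by (intro convex_on_slope_ge) auto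
  then have bdd: "bdd_below (q ` {0<..\<delta>})"
    by (intro bdd_belowI2[where m = "(f x - f (x - \<delta> *\<^sub>R d)) / \<delta>"]) auto
  have "(q \<longlongrightarrow> Inf (q ` {0<..\<delta>})) (at_right 0)"
  proof (rule order_tendstoI)
    fix a assume a: "a < Inf (q ` {0<..\<delta>})"
    have "\<forall>\<^sub>F t in at_right 0. t < \<delta>" "\<forall>\<^sub>F t in at_right 0. 0 < (t::real)"
      using \<delta> eventually_at_right_real[of 0 \<delta>] by (auto elim: eventually_mono)
    then show "\<forall>\<^sub>F t in at_right 0. a < q t"
    proof eventually_elim
      case (elim t)
      then have "Inf (q ` {0<..\<delta>}) \<le> q t" by (intro cInf_lower bdd) auto
      with a show ?case by simp
    qed
  next
    fix a assume "Inf (q ` {0<..\<delta>}) < a"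
    then obtain s where s: "0 < s" "s \<le> \<delta>" "q s < a"
      using cInf_less_iff[OF _ bdd] \<delta> by auto
    then have "\<forall>\<^sub>F t in at_right 0. 0 < t \<and> t < s"
      using eventually_at_right_real[of 0 s] by simp
    then show "\<forall>\<^sub>F t in at_right 0. q t < a"
    proof eventually_elim
      case (elim t)
      then have "q t \<le> q s" using s by (intro mono) auto
      with s show ?case by simp
    qed
  qed
  then have "has_dir_deriv f x d (Inf (q ` {0<..\<delta>}))"
    by (simp add: has_dir_deriv_def q_def[abs_def])
  then show ?thesis
    using has_dir_deriv_eq by metis
qed

text \<open>The directional derivative is a lower bound for the slopes towards \<open>y\<close>, of which the
  difference \<open>f y - f x\<close> is one. For a sequence tangent to a set this lower estimate
  replaces differentiability of the convex term.\<close>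
lemma convex_ge_dir_deriv:
  fixes f :: "'a::euclidean_space \<Rightarrow> real"
  assumes f: "convex_on S f" and S: "open S" "x \<in> S" "y \<in> S"
  shows "f x + dir_deriv f x (y - x) \<le> f y"
proof -
  have "\<forall>\<^sub>F t in at_right 0. (f (x + t *\<^sub>R (y - x)) - f x) / t \<le> f y - f x"
    using eventually_at_right_real[of 0 "1::real", OF zero_less_one]
  proof eventually_elim
    case (elim t)
    have "(f (x + t *\<^sub>R (y - x)) - f x) / t \<le> (f (x + 1 *\<^sub>R (y - x)) - f x) / 1"
      using f S elim by (intro convex_on_slope_mono) auto
    then show ?case by simp
  qed
  then have "dir_deriv f x (y - x) \<le> f y - f x"
    using convex_has_dir_deriv[OF f S(1,2), of "y - x"] unfolding has_dir_deriv_def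
    by (intro tendsto_upperbound) auto
  then show ?thesis by simp
qed

text \<open>Convexity on the whole space makes the directional derivative continuous in the direction,
  which is how it will mostly be used.\<close>
lemma convex_on_dir_deriv:
  fixes f :: "'a::euclidean_space \<Rightarrow> real"
  assumes f: "convex_on S f" and S: "open S" "x \<in> S"
  shows "convex_on UNIV (dir_deriv f x)"
proof (rule convex_onI)
  fix l :: real and d e :: 'a
  assume l: "0 < l" "l < 1"
  note lim = convex_has_dir_deriv[OF f S, unfolded has_dir_deriv_def]
  have "\<forall>\<^sub>F t in at_right 0. (f (x + t *\<^sub>R ((1 - l) *\<^sub>R d + l *\<^sub>R e)) - f x) / t
      \<le> (1 - l) * ((f (x + t *\<^sub>R d) - f x) / t) + l * ((f (x + t *\<^sub>R e) - f x) / t)"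
    using eventually_open_direction[OF S, of d] eventually_open_direction[OF S, of e]
      eventually_at_right_less[of "0::real"]
  proof eventually_elim
    case (elim t)
    have "f ((1 - l) *\<^sub>R (x + t *\<^sub>R d) + l *\<^sub>R (x + t *\<^sub>R e))
        \<le> (1 - l) * f (x + t *\<^sub>R d) + l * f (x + t *\<^sub>R e)"
      using f l elim by (intro convex_onD) auto
    also have "(1 - l) *\<^sub>R (x + t *\<^sub>R d) + l *\<^sub>R (x + t *\<^sub>R e) = x + t *\<^sub>R ((1 - l) *\<^sub>R d + l *\<^sub>R e)"
      by (simp add: algebra_simps)
    finally have "(f (x + t *\<^sub>R ((1 - l) *\<^sub>R d + l *\<^sub>R e)) - f x) / t
        \<le> ((1 - l) * f (x + t *\<^sub>R d) + l * f (x + t *\<^sub>R e) - f x) / t"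
      using elim by (intro divide_right_mono) auto
    also have "\<dots> = (1 - l) * ((f (x + t *\<^sub>R d) - f x) / t) + l * ((f (x + t *\<^sub>R e) - f x) / t)"
      using elim by (simp add: field_simps)
    finally show ?case .
  qed
  then show "dir_deriv f x ((1 - l) *\<^sub>R d + l *\<^sub>R e) \<le> (1 - l) * dir_deriv f x d + l * dir_deriv f x e"
    by (rule tendsto_le[rotated 3]) (intro lim tendsto_intros trivial_limit_at_right_real)+
qed auto

section \<open>Maxima and powers of positive parts\<close>

lemma tendsto_Max_image:
  fixes g :: "'j \<Rightarrow> 'b \<Rightarrow> real"
  assumes "finite J" "J \<noteq> {}" and "\<And>j. j \<in> J \<Longrightarrow> (g j \<longlongrightarrow> a j) F"
  shows "((\<lambda>k. Max ((\<lambda>j. g j k) ` J)) \<longlongrightarrow> Max (a ` J)) F"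
  using assms by (induction J rule: finite_ne_induct) (auto intro!: tendsto_max)

text \<open>A maximum moves with the steepest of the functions that attain it: the steepest one bounds the
  quotient from below, and every other function either grows more slowly or starts strictly below
  the maximum and cannot catch up in a short step.\<close>
lemma Max_difference_quotient:
  fixes g :: "'j \<Rightarrow> 'b \<Rightarrow> real"
  assumes J: "finite J" and \<tau>: "(\<tau> \<longlongrightarrow> 0) F" and pos: "\<forall>\<^sub>F k in F. \<tau> k > 0"
    and lim: "\<And>i. i \<in> J \<Longrightarrow> ((\<lambda>k. (g i k - a i) / \<tau> k) \<longlongrightarrow> D i) F"
    and j: "j \<in> J" "a j = Max (a ` J)"
    and steepest: "\<And>i. \<lbrakk>i \<in> J; a i = Max (a ` J)\<rbrakk> \<Longrightarrow> D i \<le> D j"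
  shows "((\<lambda>k. (Max ((\<lambda>i. g i k) ` J) - Max (a ` J)) / \<tau> k) \<longlongrightarrow> D j) F"
proof (rule order_tendstoI)
  fix c assume "c < D j"
  from order_tendstoD(1)[OF lim[OF j(1)] this] pos
  show "\<forall>\<^sub>F k in F. c < (Max ((\<lambda>i. g i k) ` J) - Max (a ` J)) / \<tau> k"
  proof eventually_elim
    case (elim k)
    have "g j k \<le> Max ((\<lambda>i. g i k) ` J)"
      using J j by auto
    then have "(g j k - a j) / \<tau> k \<le> (Max ((\<lambda>i. g i k) ` J) - a j) / \<tau> k"
      using elim by (intro divide_right_mono) auto
    with elim j show ?case by simp
  qed
next
  fix c assume c: "D j < c"
  have "\<forall>\<^sub>F k in F. g i k < Max (a ` J) + c * \<tau> k" if i: "i \<in> J" for i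
  proof (cases "a i = Max (a ` J)")
    case True
    with steepest[OF i] c have "D i < c" by simp
    from order_tendstoD(2)[OF lim[OF i] this] pos show ?thesis
      by eventually_elim (use True in \<open>auto simp: field_simps\<close>)
  next
    case False
    with i J have "a i < Max (a ` J)"
      by (simp add: order.strict_iff_order)
    moreover have "((\<lambda>k. a i + \<tau> k * ((g i k - a i) / \<tau> k) - c * \<tau> k) \<longlongrightarrow> a i + 0 * D i - c * 0) F"
      by (intro tendsto_intros \<tau> lim i)
    ultimately have "\<forall>\<^sub>F k in F. a i + \<tau> k * ((g i k - a i) / \<tau> k) - c * \<tau> k < Max (a ` J)"
      by (intro order_tendstoD) auto
    with pos show ?thesis
      by eventually_elim auto
  qed
  then have "\<forall>\<^sub>F k in F. \<forall>i\<in>J. g i k < Max (a ` J) + c * \<tau> k"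
    using J by (intro eventually_ball_finite) auto
  with pos show "\<forall>\<^sub>F k in F. (Max ((\<lambda>i. g i k) ` J) - Max (a ` J)) / \<tau> k < c"
  proof eventually_elim
    case (elim k)
    have "Max ((\<lambda>i. g i k) ` J) < Max (a ` J) + c * \<tau> k"
      using J j elim by (subst Max_less_iff) auto
    with elim show ?case by (simp add: field_simps)
  qed
qed

text \<open>The one-sided derivative of the \<open>p\<close>-th power of the positive part at \<open>a\<close>, in a
  direction of slope \<open>D\<close>. Only the case \<open>a = 0\<close>, \<open>p = 1\<close> is not linear in \<open>D\<close>.\<close>
definition pos_powr_slope :: "real \<Rightarrow> real \<Rightarrow> real \<Rightarrow> real" where
  "pos_powr_slope p a D =
     (if a > 0 then p * a powr (p - 1) * D else if a = 0 \<and> p = 1 then max D 0 else 0)"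

text \<open>What matters later is that the new slope depends on \<open>f\<close> only through its value and slope at
  \<open>x\<close>, so that functions which agree to first order still do so after this operation. Away from
  the kink at \<open>0\<close> this is the chain rule; at the kink the quotient factors as
  \<open>t powr (p - 1)\<close> times the \<open>p\<close>-th power of the positive part of the quotient of \<open>f\<close>.\<close>
lemma has_dir_deriv_pos_powr:
  assumes f: "has_dir_deriv f x d D" and p: "p \<ge> 1"
  shows "has_dir_deriv (\<lambda>y. max (f y) 0 powr p) x d (pos_powr_slope p (f x) D)"
proof -
  \<comment> \<open>Writing the increment of \<open>f\<close> as \<open>t\<close> times a convergent factor reduces the chain rule
    to a difference quotient on the real line with varying direction.\<close>
  define v where "v t = (f (x + t *\<^sub>R d) - f x) / t" for t
  have v: "(v \<longlongrightarrow> D) (at_right 0)"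
    using f by (simp add: has_dir_deriv_def v_def[abs_def])
  have v_eq: "f (x + t *\<^sub>R d) = f x + t *\<^sub>R v t" if "t > 0" for t
    using that by (simp add: v_def)
  note pos = eventually_at_right_less[of "0::real"]
  have id0: "((\<lambda>t. t) \<longlongrightarrow> 0) (at_right (0::real))"
    by (rule tendsto_ident_at)
  have chain: "has_dir_deriv (\<lambda>y. max (f y) 0 powr p) x d (E * D)"
    if "((\<lambda>s. max s 0 powr p) has_real_derivative E) (at (f x))" for E
  proof -
    have "((\<lambda>s. max s 0 powr p) has_derivative (*) E) (at (f x))"
      using that by (simp add: has_field_derivative_def)
    from has_derivative_difference_quotient[OF this id0 pos v]
    show ?thesis
      unfolding has_dir_deriv_def
      by (rule Lim_transform_eventually) (use pos in eventually_elim, simp add: v_eq)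
  qed
  consider "f x > 0" | "f x < 0" | "f x = 0" by linarith
  then show ?thesis
  proof cases
    case 1
    have "((\<lambda>s. s powr p) has_real_derivative p * f x powr (p - 1)) (at (f x))"
      using 1 by (rule has_real_derivative_powr)
    then have "((\<lambda>s. max s 0 powr p) has_real_derivative p * f x powr (p - 1)) (at (f x))"
      by (rule has_field_derivative_transform_within_open[where S = "{0<..}"]) (use 1 in auto)
    from chain[OF this] 1 show ?thesis by (simp add: pos_powr_slope_def)
  next
    case 2
    have "((\<lambda>s. 0) has_real_derivative 0) (at (f x))"
      by simp
    then have "((\<lambda>s. max s 0 powr p) has_real_derivative 0) (at (f x))"
      by (rule has_field_derivative_transform_within_open[where S = "{..<0}"]) (use 2 in auto)
    from chain[OF this] 2 show ?thesis by (simp add: pos_powr_slope_def)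
  next
    case 3
    have "((\<lambda>t. t powr (p - 1)) \<longlongrightarrow> (if p = 1 then 1 else 0)) (at_right (0::real))"
    proof (cases "p = 1")
      case True
      show ?thesis
        by (rule Lim_transform_eventually[OF tendsto_const])
           (use pos in eventually_elim, simp add: True)
    next
      case False
      have "((\<lambda>t. t powr (p - 1)) \<longlongrightarrow> 0 powr (p - 1)) (at_right (0::real))"
        using False p eventually_mono[OF pos]
        by (intro tendsto_powr2 tendsto_intros tendsto_ident_at) (auto simp: less_imp_le)
      with False show ?thesis by simp
    qed
    from tendsto_mult[OF this tendsto_powr2[OF tendsto_max[OF v tendsto_const[of 0]] tendsto_const[of p]]]
    have "((\<lambda>t. t powr (p - 1) * max (v t) 0 powr p)
        \<longlongrightarrow> (if p = 1 then 1 else 0) * max D 0 powr p) (at_right 0)"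
      using p by simp
    also have "(if p = 1 then 1 else 0) * max D 0 powr p = pos_powr_slope p (f x) D"
      by (simp add: 3 pos_powr_slope_def)
    finally show ?thesis
      unfolding has_dir_deriv_def
    proof (rule Lim_transform_eventually)
      show "\<forall>\<^sub>F t in at_right 0. t powr (p - 1) * max (v t) 0 powr p
          = (max (f (x + t *\<^sub>R d)) 0 powr p - max (f x) 0 powr p) / t"
        using pos
      proof eventually_elim
        case (elim t)
        have "max (t * v t) 0 = t * max (v t) 0"
          using elim by (simp add: max_def mult_le_0_iff)
        with elim 3 show ?case
          by (simp add: v_eq powr_mult powr_diff)
      qed
    qed
  qed
qed

section \<open>Tangent cones, polyhedra and piecewise affine functions\<close>

lemma tangent_cone_mono: "Y \<subseteq> Z \<Longrightarrow> tangent_cone Y x \<subseteq> tangent_cone Z x"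
  unfolding tangent_cone_def by blast

lemma tangent_coneE:
  assumes "d \<in> tangent_cone Y x"
  obtains \<tau> v where "\<And>k. x + \<tau> k *\<^sub>R v k \<in> Y" "\<And>k::nat. \<tau> k > 0" "\<tau> \<longlonglongrightarrow> 0" "v \<longlonglongrightarrow> d"
proof -
  from assms obtain u \<tau> where *: "\<And>k. u k \<in> Y" "\<And>k. \<tau> k > 0" "\<tau> \<longlonglongrightarrow> 0"
    "(\<lambda>k. (u k - x) /\<^sub>R \<tau> k) \<longlonglongrightarrow> d"
    unfolding tangent_cone_def by blast
  have "x + \<tau> k *\<^sub>R ((u k - x) /\<^sub>R \<tau> k) = u k" for k
    using *(2)[of k] by simp
  with * show ?thesis
    by (intro that[of \<tau> "\<lambda>k. (u k - x) /\<^sub>R \<tau> k"]) auto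
qed

text \<open>The quotients approximating a tangent direction are positive multiples of differences
  \<open>y - x\<close>. The cone generated by these differences is convex together with its closure when \<open>X\<close> is
  convex, so two tangent directions can be combined without matching their step sizes.\<close>
lemma tangent_cone_subset_closure:
  "tangent_cone X x \<subseteq> closure (cone hull ((\<lambda>y. y - x) ` X))"
proof
  fix d assume "d \<in> tangent_cone X x"
  then obtain \<tau> v where *: "\<And>k. x + \<tau> k *\<^sub>R v k \<in> X" "\<And>k::nat. \<tau> k > 0" "v \<longlonglongrightarrow> d"
    by (metis tangent_coneE)
  have "v k \<in> cone hull ((\<lambda>y. y - x) ` X)" for k
  proof -
    have "v k = (1 / \<tau> k) *\<^sub>R ((x + \<tau> k *\<^sub>R v k) - x)" "1 / \<tau> k \<ge> 0"
      using *(2)[of k] by auto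
    with *(1)[of k] show ?thesis
      unfolding cone_hull_expl by blast
  qed
  with *(3) show "d \<in> closure (cone hull ((\<lambda>y. y - x) ` X))"
    unfolding closure_sequential by blast
qed

lemma convex_closure_feasible_directions:
  fixes X :: "'a::real_normed_vector set"
  shows "convex X \<Longrightarrow> convex (closure (cone hull ((\<lambda>y. y - x) ` X)))"
  by (intro convex_closure convex_cone_hull convex_translation_subtract)

text \<open>Each bounding half-space is either slack at \<open>x\<close>, and stays so for a short step, or tight, and
  then its normal has nonpositive inner product with every tangent direction.\<close>
lemma polyhedron_tangent_ray:
  assumes X: "polyhedron X" "x \<in> X" and d: "d \<in> tangent_cone X x"
  shows "\<forall>\<^sub>F t in at_right 0. x + t *\<^sub>R d \<in> X"
proof -
  from X(1)[unfolded polyhedron_def] obtain H where H: "finite H" "X = \<Inter> H"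
    and half: "\<forall>h\<in>H. \<exists>a b. a \<noteq> 0 \<and> h = {y. a \<bullet> y \<le> b}"
    by (elim exE conjE)
  obtain \<tau> v where v: "\<And>k. x + \<tau> k *\<^sub>R v k \<in> X" "\<And>k::nat. \<tau> k > 0" "v \<longlonglongrightarrow> d"
    using tangent_coneE[OF d] by metis
  have "\<forall>\<^sub>F t in at_right 0. x + t *\<^sub>R d \<in> h" if h: "h \<in> H" for h
  proof -
    obtain a b where ab: "h = {y. a \<bullet> y \<le> b}"
      using bspec[OF half h] by (elim exE conjE)
    have in_h: "a \<bullet> y \<le> b" if "y \<in> X" for y
      using that h ab H(2) by blast
    show ?thesis
    proof (cases "a \<bullet> x = b")
      case True
      have "a \<bullet> v k \<le> 0" for k
        using in_h[OF v(1)[of k]] v(2)[of k] True by (simp add: inner_add_right mult_le_0_iff)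
      moreover have "(\<lambda>k. a \<bullet> v k) \<longlonglongrightarrow> a \<bullet> d"
        by (intro tendsto_intros v)
      ultimately have "a \<bullet> d \<le> 0"
        by (intro tendsto_upperbound) auto
      with True show ?thesis
        using eventually_at_right_less[of "0::real"]
        by (auto simp: ab inner_add_right mult_le_0_iff elim!: eventually_mono)
    next
      case False
      with in_h[OF X(2)] have "x \<in> {y. a \<bullet> y < b}" by simp
      from eventually_open_direction[OF open_halfspace_lt this, of d] show ?thesis
        by (rule eventually_mono) (simp add: ab)
    qed
  qed
  then have "\<forall>\<^sub>F t in at_right 0. \<forall>h\<in>H. x + t *\<^sub>R d \<in> h"
    using H(1) by (intro eventually_ball_finite) auto
  then show ?thesis
    by (rule eventually_mono) (simp add: H(2))
qed

text \<open>One of the finitely many pieces contains points of the ray arbitrarily close to \<open>x\<close>. Being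
  closed and convex it contains \<open>x\<close> and a whole initial segment of the ray.\<close>
lemma piecewise_affine_ray:
  assumes f: "piecewise_affine_on X f" and ray: "\<forall>\<^sub>F t in at_right 0. x + t *\<^sub>R d \<in> X"
  obtains s where "\<forall>\<^sub>F t in at_right 0. f (x + t *\<^sub>R d) = f x + t * s"
proof -
  obtain \<C> where C: "finite \<C>" "\<Union>\<C> = X" "\<And>C. C \<in> \<C> \<Longrightarrow> polyhedron C \<and> affine_fun_on C f"
    using f unfolding piecewise_affine_on_def by blast
  have "\<forall>\<^sub>F t in at_right 0. \<exists>C\<in>\<C>. x + t *\<^sub>R d \<in> C"
    using ray C(2) by auto
  then have "\<exists>\<^sub>F t in at_right 0. \<exists>C\<in>\<C>. x + t *\<^sub>R d \<in> C"
    by (intro eventually_frequently) auto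
  then obtain C where CC: "C \<in> \<C>" and freq: "\<exists>\<^sub>F t in at_right 0. x + t *\<^sub>R d \<in> C"
    using frequently_bex_finite[OF C(1)] by fast
  have cl: "closed C" "convex C"
    using C(3)[OF CC] polyhedron_imp_closed polyhedron_imp_convex by auto
  have x: "x \<in> C"
  proof (rule ccontr)
    assume "x \<notin> C"
    then have "\<forall>\<^sub>F t in at_right 0. x + t *\<^sub>R d \<in> - C"
      using cl by (intro eventually_open_direction) auto
    with freq show False
      by (simp add: frequently_def)
  qed
  obtain s where s: "s > 0" "x + s *\<^sub>R d \<in> C"
    using frequently_ex[OF frequently_eventually_frequently[OF freq eventually_at_right_less[of 0]]]
    by blast
  obtain a b where ab: "\<And>y. y \<in> C \<Longrightarrow> f y = a \<bullet> y + b"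
    using C(3)[OF CC] unfolding affine_fun_on_def by blast
  have "\<forall>\<^sub>F t in at_right 0. f (x + t *\<^sub>R d) = f x + t * (a \<bullet> d)"
    using eventually_at_right_real[OF s(1)]
  proof eventually_elim
    case (elim t)
    then have "x + t *\<^sub>R d \<in> C"
      using convex_ray_mem[OF cl(2) x s(2)] by simp
    then show ?case
      using ab[OF x] by (simp add: ab inner_add_right)
  qed
  then show ?thesis by (rule that)
qed

text \<open>The gradient need not be the coefficient vector of the affine expression, as \<open>X\<close> may have an
  empty interior, but both have the same inner product with differences of points of \<open>X\<close>.\<close>
lemma affine_linearization:
  assumes f: "affine_fun_on X f" "f differentiable (at x)" and X: "convex X" "x \<in> X" "y \<in> X"
  shows "linearization f x y = f y"
proof -
  obtain a b where ab: "\<And>y. y \<in> X \<Longrightarrow> f y = a \<bullet> y + b"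
    using f(1) unfolding affine_fun_on_def by blast
  have "((\<lambda>t. (f (x + t *\<^sub>R (y - x)) - f x) / t) \<longlongrightarrow> gradient f x \<bullet> (y - x)) (at_right 0)"
    by (rule has_derivative_difference_quotient[OF gradient_has_derivative[OF f(2)]
          tendsto_ident_at eventually_at_right_less tendsto_const])
  moreover have "((\<lambda>t. (f (x + t *\<^sub>R (y - x)) - f x) / t) \<longlongrightarrow> a \<bullet> (y - x)) (at_right 0)"
  proof (rule Lim_transform_eventually[OF tendsto_const])
    show "\<forall>\<^sub>F t in at_right 0. a \<bullet> (y - x) = (f (x + t *\<^sub>R (y - x)) - f x) / t"
      using convex_eventually_ray_mem[OF X] eventually_at_right_less[of "0::real"]
      by eventually_elim (use X in \<open>simp add: ab inner_add_right\<close>)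
  qed
  ultimately have "gradient f x \<bullet> (y - x) = a \<bullet> (y - x)"
    using tendsto_unique trivial_limit_at_right_real by blast
  then show ?thesis
    using X by (simp add: linearization_def ab inner_diff_right)
qed

section \<open>First-order behaviour of a DC program\<close>

text \<open>The slope in direction \<open>d\<close> of the \<open>i\<close>-th model with base point \<open>z\<close>; the quadratic term of the
  model contributes nothing. These are the expressions in the constraint qualification.\<close>
definition dir_model :: "'a::euclidean_space dc_data \<Rightarrow> nat \<Rightarrow> nat \<Rightarrow> 'a \<Rightarrow> 'a \<Rightarrow> real" where
  "dir_model P i j z d =
     gradient (phi P i) z \<bullet> d + dir_deriv (zeta P i) z d - gradient (psi P i j) z \<bullet> d"

definition steepest_pieces :: "'a::euclidean_space dc_data \<Rightarrow> nat \<Rightarrow> 'a \<Rightarrow> 'a \<Rightarrow> nat set" where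
  "steepest_pieces P i z d =
     {j \<in> active_pieces P i z. \<forall>l\<in>active_pieces P i z.
        gradient (psi P i l) z \<bullet> d \<le> gradient (psi P i j) z \<bullet> d}"

lemma dc_programD:
  assumes "dc_program P" "i \<le> ncon P"
  shows "open (dom P)" "ground P \<subseteq> dom P" "convex (ground P)" "closed (ground P)"
    "npieces P i \<ge> 1" "convex_on (dom P) (zeta P i)" "continuous_on (dom P) (zeta P i)"
    "convex_on (dom P) (phi P i)" "C1_on (dom P) (phi P i)"
    "\<And>j. j \<in> {1..npieces P i} \<Longrightarrow> C1_on (dom P) (psi P i j)"
  using assms by (auto simp: dc_program_def)

lemma C1_on_has_derivative:
  "C1_on S f \<Longrightarrow> x \<in> S \<Longrightarrow> (f has_derivative (\<lambda>h. gradient f x \<bullet> h)) (at x)"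
  by (simp add: C1_on_def gradient_has_derivative)

lemma C1_on_tendsto:
  assumes "C1_on S f" "x \<in> S" "(u \<longlongrightarrow> x) F"
  shows "((\<lambda>k. f (u k)) \<longlongrightarrow> f x) F"
  using has_derivative_continuous[OF C1_on_has_derivative[OF assms(1,2)]] assms(3)
  by (rule isCont_tendsto_compose)

lemma C1_on_gradient_tendsto:
  assumes "C1_on S f" "open S" "x \<in> S" "(u \<longlongrightarrow> x) F"
  shows "((\<lambda>k. gradient f (u k)) \<longlongrightarrow> gradient f x) F"
proof -
  have "isCont (gradient f) x"
    using assms(1-3) by (auto simp: C1_on_def continuous_on_eq_continuous_at)
  then show ?thesis
    using assms(4) by (rule isCont_tendsto_compose)
qed

lemma active_piecesD:
  "j \<in> active_pieces P i z \<Longrightarrow> j \<in> {1..npieces P i}"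
  "j \<in> active_pieces P i z \<Longrightarrow> psi P i j z = psi_max P i z"
  by (auto simp: active_pieces_def)

lemma active_pieces_nonempty:
  assumes "npieces P i \<ge> 1"
  shows "active_pieces P i z \<noteq> {}"
proof -
  have "psi_max P i z \<in> (\<lambda>j. psi P i j z) ` {1..npieces P i}"
    unfolding psi_max_def using assms by (intro Max_in) auto
  then show ?thesis by (auto simp: active_pieces_def)
qed

lemma steepest_pieces_nonempty:
  fixes P :: "'a::euclidean_space dc_data"
  assumes "npieces P i \<ge> 1"
  obtains j where "j \<in> steepest_pieces P i z d"
proof -
  have fin: "finite (active_pieces P i z)"
    by (simp add: active_pieces_def)
  define slope where "slope j = gradient (psi P i j) z \<bullet> d" for j
  have "Max (slope ` active_pieces P i z) \<in> slope ` active_pieces P i z"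
    using fin active_pieces_nonempty[OF assms] by (intro Max_in) auto
  then obtain j where j: "j \<in> active_pieces P i z" "slope j = Max (slope ` active_pieces P i z)"
    by auto
  then have "slope l \<le> slope j" if "l \<in> active_pieces P i z" for l
    using fin that by simp
  with j(1) show ?thesis
    by (intro that[of j]) (auto simp: steepest_pieces_def slope_def)
qed

lemma psi_max_tendsto:
  assumes P: "dc_program P" "i \<le> ncon P" "z \<in> dom P" and u: "(u \<longlongrightarrow> z) F"
  shows "((\<lambda>k. psi_max P i (u k)) \<longlongrightarrow> psi_max P i z) F"
  unfolding psi_max_def
proof (rule tendsto_Max_image)
  show "((\<lambda>k. psi P i j (u k)) \<longlongrightarrow> psi P i j z) F" if "j \<in> {1..npieces P i}" for j
    using dc_programD(10)[OF P(1,2) that] P(3) u by (rule C1_on_tendsto)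
qed (use dc_programD(5)[OF P(1,2)] in auto)

lemma zeta_tendsto:
  assumes P: "dc_program P" "i \<le> ncon P" "z \<in> dom P" and u: "(u \<longlongrightarrow> z) F"
  shows "((\<lambda>k. zeta P i (u k)) \<longlongrightarrow> zeta P i z) F"
proof -
  have "isCont (zeta P i) z"
    using dc_programD(1,7)[OF P(1,2)] P(3) by (simp add: continuous_on_eq_continuous_at)
  then show ?thesis
    using u by (rule isCont_tendsto_compose)
qed

lemma dc_fun_tendsto:
  assumes P: "dc_program P" "i \<le> ncon P" "z \<in> dom P" and u: "(u \<longlongrightarrow> z) F"
  shows "((\<lambda>k. dc_fun P i (u k)) \<longlongrightarrow> dc_fun P i z) F"
  unfolding dc_fun_def
  by (intro tendsto_intros psi_max_tendsto[OF P u] zeta_tendsto[OF P u]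
      C1_on_tendsto[OF dc_programD(9)[OF P(1,2)] P(3) u])

lemma psi_max_difference_quotient:
  assumes P: "dc_program P" "i \<le> ncon P" "z \<in> dom P" and j: "j \<in> steepest_pieces P i z d"
    and lim: "(\<tau> \<longlongrightarrow> 0) F" "\<forall>\<^sub>F k in F. \<tau> k > 0" "(v \<longlongrightarrow> d) F"
  shows "((\<lambda>k. (psi_max P i (z + \<tau> k *\<^sub>R v k) - psi_max P i z) / \<tau> k)
    \<longlongrightarrow> gradient (psi P i j) z \<bullet> d) F"
  unfolding psi_max_def
proof (rule Max_difference_quotient)
  fix l assume "l \<in> {1..npieces P i}"
  then show "((\<lambda>k. (psi P i l (z + \<tau> k *\<^sub>R v k) - psi P i l z) / \<tau> k)
      \<longlongrightarrow> gradient (psi P i l) z \<bullet> d) F"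
    using dc_programD(10)[OF P(1,2)] P(3) lim
    by (intro has_derivative_difference_quotient C1_on_has_derivative) auto
qed (use lim j in \<open>simp_all add: steepest_pieces_def active_pieces_def psi_max_def\<close>)

lemma zeta_has_dir_deriv:
  assumes P: "dc_program P" "i \<le> ncon P" "z \<in> dom P"
  shows "has_dir_deriv (zeta P i) z d (dir_deriv (zeta P i) z d)"
  using dc_programD[OF P(1,2)] P(3) by (intro convex_has_dir_deriv) auto

lemma dc_fun_has_dir_deriv:
  assumes P: "dc_program P" "i \<le> ncon P" "z \<in> dom P" and j: "j \<in> steepest_pieces P i z d"
  shows "has_dir_deriv (dc_fun P i) z d (dir_model P i j z d)"
proof -
  note lim = tendsto_ident_at eventually_at_right_less[of "0::real"] tendsto_const[of d]
  have "((\<lambda>t. (phi P i (z + t *\<^sub>R d) - phi P i z) / t + (zeta P i (z + t *\<^sub>R d) - zeta P i z) / t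
        - (psi_max P i (z + t *\<^sub>R d) - psi_max P i z) / t) \<longlongrightarrow> dir_model P i j z d) (at_right 0)"
    unfolding dir_model_def
    by (intro tendsto_intros psi_max_difference_quotient[OF P j lim]
        zeta_has_dir_deriv[OF P, unfolded has_dir_deriv_def]
        has_derivative_difference_quotient[OF C1_on_has_derivative[OF dc_programD(9)[OF P(1,2)] P(3)] lim])
  moreover have "(phi P i (z + t *\<^sub>R d) - phi P i z) / t + (zeta P i (z + t *\<^sub>R d) - zeta P i z) / t
      - (psi_max P i (z + t *\<^sub>R d) - psi_max P i z) / t
      = (dc_fun P i (z + t *\<^sub>R d) - dc_fun P i z) / t" for t
    by (simp add: dc_fun_def diff_divide_distrib add_divide_distrib)
  ultimately show ?thesis
    by (simp add: has_dir_deriv_def)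
qed

lemma model_base_point:
  "j \<in> active_pieces P i z \<Longrightarrow> model P i j z z = dc_fun P i z"
  by (simp add: model_def phi_hat_def linearization_def dc_fun_def active_piecesD)

lemma model_has_dir_deriv:
  assumes P: "dc_program P" "i \<le> ncon P" "z \<in> dom P"
  shows "has_dir_deriv (model P i j z) z d (dir_model P i j z d)"
proof -
  have "((\<lambda>t. gradient (phi P i) z \<bullet> d + lip P i / 2 * (norm d)\<^sup>2 * t
        + (zeta P i (z + t *\<^sub>R d) - zeta P i z) / t - gradient (psi P i j) z \<bullet> d)
      \<longlongrightarrow> gradient (phi P i) z \<bullet> d + lip P i / 2 * (norm d)\<^sup>2 * 0
        + dir_deriv (zeta P i) z d - gradient (psi P i j) z \<bullet> d) (at_right 0)"
    by (intro tendsto_intros zeta_has_dir_deriv[OF P, unfolded has_dir_deriv_def])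
  then have "((\<lambda>t. gradient (phi P i) z \<bullet> d + lip P i / 2 * (norm d)\<^sup>2 * t
        + (zeta P i (z + t *\<^sub>R d) - zeta P i z) / t - gradient (psi P i j) z \<bullet> d)
      \<longlongrightarrow> dir_model P i j z d) (at_right 0)"
    by (simp add: dir_model_def)
  then show ?thesis
    unfolding has_dir_deriv_def
  proof (rule Lim_transform_eventually)
    show "\<forall>\<^sub>F t in at_right 0. gradient (phi P i) z \<bullet> d + lip P i / 2 * (norm d)\<^sup>2 * t
        + (zeta P i (z + t *\<^sub>R d) - zeta P i z) / t - gradient (psi P i j) z \<bullet> d
        = (model P i j z (z + t *\<^sub>R d) - model P i j z z) / t"
      using eventually_at_right_less[of "0::real"]
    proof eventually_elim
      case (elim t)
      have "model P i j z (z + t *\<^sub>R d) - model P i j z z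
          = t * (gradient (phi P i) z \<bullet> d) + t * (lip P i / 2 * (norm d)\<^sup>2 * t)
            + (zeta P i (z + t *\<^sub>R d) - zeta P i z) - t * (gradient (psi P i j) z \<bullet> d)"
        by (simp add: model_def phi_hat_def linearization_def power_mult_distrib)
           (simp add: power2_eq_square)
      with elim show ?case
        by (simp add: add_divide_distrib diff_divide_distrib)
    qed
  qed
qed

lemma model_tendsto:
  assumes P: "dc_program P" "i \<le> ncon P" "z \<in> dom P" and j: "j \<in> {1..npieces P i}"
    and u: "(u \<longlongrightarrow> z) F"
  shows "((\<lambda>k. model P i j (u k) y) \<longlongrightarrow> model P i j z y) F"
  unfolding model_def phi_hat_def linearization_def
proof -
  note C1 = dc_programD(9)[OF P(1,2)] dc_programD(10)[OF P(1,2) j]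
  show "((\<lambda>k. phi P i (u k) + gradient (phi P i) (u k) \<bullet> (y - u k)
      + lip P i / 2 * (norm (y - u k))\<^sup>2 + zeta P i y
      - (psi P i j (u k) + gradient (psi P i j) (u k) \<bullet> (y - u k))) \<longlongrightarrow>
      phi P i z + gradient (phi P i) z \<bullet> (y - z) + lip P i / 2 * (norm (y - z))\<^sup>2 + zeta P i y
      - (psi P i j z + gradient (psi P i j) z \<bullet> (y - z))) F"
    by (intro tendsto_intros u C1[THEN C1_on_tendsto[OF _ P(3) u]]
        C1[THEN C1_on_gradient_tendsto[OF _ dc_programD(1)[OF P(1,2)] P(3) u]])
qed

lemma convex_on_dir_model:
  assumes P: "dc_program P" "i \<le> ncon P" "z \<in> dom P"
  shows "convex_on UNIV (dir_model P i j z)"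
proof (rule convex_onI)
  fix t :: real and d e :: 'a
  assume "0 < t" "t < 1"
  moreover have "convex_on UNIV (dir_deriv (zeta P i) z)"
    using dc_programD[OF P(1,2)] P(3) by (intro convex_on_dir_deriv) auto
  ultimately have "dir_deriv (zeta P i) z ((1 - t) *\<^sub>R d + t *\<^sub>R e)
      \<le> (1 - t) * dir_deriv (zeta P i) z d + t * dir_deriv (zeta P i) z e"
    by (intro convex_onD) auto
  moreover have inner_combination: "g \<bullet> ((1 - t) *\<^sub>R d + t *\<^sub>R e) = (1 - t) * (g \<bullet> d) + t * (g \<bullet> e)" for g
    by (simp only: inner_add_right inner_scaleR_right)
  ultimately show "dir_model P i j z ((1 - t) *\<^sub>R d + t *\<^sub>R e)
      \<le> (1 - t) * dir_model P i j z d + t * dir_model P i j z e"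
    unfolding dir_model_def distrib_left right_diff_distrib inner_combination by linarith
qed auto

lemma dir_model_tendsto:
  assumes P: "dc_program P" "i \<le> ncon P" "z \<in> dom P" and "(v \<longlongrightarrow> d) F"
  shows "((\<lambda>k. dir_model P i j z (v k)) \<longlongrightarrow> dir_model P i j z d) F"
proof -
  have "isCont (dir_model P i j z) d"
    using convex_on_continuous[OF open_UNIV convex_on_dir_model[OF P]]
    by (simp add: continuous_on_eq_continuous_at)
  then show ?thesis
    using assms(4) by (rule isCont_tendsto_compose)
qed

lemma dir_model_scale:
  assumes P: "dc_program P" "i \<le> ncon P" "z \<in> dom P" and "c \<ge> 0"
  shows "dir_model P i j z (c *\<^sub>R d) = c * dir_model P i j z d"
  by (rule has_dir_deriv_unique[OF model_has_dir_deriv[OF P]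
        has_dir_deriv_scale[OF model_has_dir_deriv[OF P] assms(4)]])

text \<open>Along a feasible sequence tangent to \<open>d\<close> the constraint is nonpositive and at \<open>z\<close> it vanishes,
  so its difference quotients are nonpositive. In the limit the smooth part and the maximum
  contribute their slopes along \<open>d\<close>, and the convex term is bounded below by its directional
  derivative.\<close>
lemma tangent_cone_feasible_dir_model:
  assumes P: "dc_program P" and z: "z \<in> dom P" and i: "i \<in> active_constraints P z"
    and d: "d \<in> tangent_cone (feasible P) z" and j: "j \<in> steepest_pieces P i z d"
  shows "dir_model P i j z d \<le> 0"
proof -
  obtain \<tau> v where v: "\<And>k. z + \<tau> k *\<^sub>R v k \<in> feasible P" "\<And>k::nat. \<tau> k > 0"
    "\<tau> \<longlonglongrightarrow> 0" "v \<longlonglongrightarrow> d"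
    using tangent_coneE[OF d] by metis
  have iP: "i \<le> ncon P" "i \<in> {1..ncon P}" "dc_fun P i z = 0"
    using i by (auto simp: active_constraints_def)
  note Pz = P iP(1) z
  note lim = v(3) always_eventually[OF allI[OF v(2)]] v(4)
  have zeta: "convex_on (dom P) (zeta P i)" "open (dom P)"
    using dc_programD[OF P iP(1)] by auto
  have "isCont (dir_deriv (zeta P i) z) d"
    using convex_on_continuous[OF open_UNIV convex_on_dir_deriv[OF zeta z]]
    by (simp add: continuous_on_eq_continuous_at)
  then have "(\<lambda>k. dir_deriv (zeta P i) z (v k)) \<longlonglongrightarrow> dir_deriv (zeta P i) z d"
    using v(4) by (rule isCont_tendsto_compose)
  then have "(\<lambda>k. (phi P i (z + \<tau> k *\<^sub>R v k) - phi P i z) / \<tau> k + dir_deriv (zeta P i) z (v k)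
      - (psi_max P i (z + \<tau> k *\<^sub>R v k) - psi_max P i z) / \<tau> k) \<longlonglongrightarrow> dir_model P i j z d"
    unfolding dir_model_def
    by (intro tendsto_intros psi_max_difference_quotient[OF Pz j lim]
        has_derivative_difference_quotient[OF C1_on_has_derivative[OF dc_programD(9)[OF Pz(1,2)] z] lim])
  moreover have "(phi P i (z + \<tau> k *\<^sub>R v k) - phi P i z) / \<tau> k + dir_deriv (zeta P i) z (v k)
      - (psi_max P i (z + \<tau> k *\<^sub>R v k) - psi_max P i z) / \<tau> k \<le> 0" for k
  proof -
    have k: "z + \<tau> k *\<^sub>R v k \<in> ground P" "dc_fun P i (z + \<tau> k *\<^sub>R v k) \<le> 0"
      using v(1)[of k] iP by (auto simp: feasible_def)
    then have "zeta P i z + dir_deriv (zeta P i) z ((z + \<tau> k *\<^sub>R v k) - z) \<le> zeta P i (z + \<tau> k *\<^sub>R v k)"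
      using dc_programD(2)[OF P iP(1)] by (intro convex_ge_dir_deriv[OF zeta z]) auto
    moreover have "dir_deriv (zeta P i) z (\<tau> k *\<^sub>R v k) = \<tau> k * dir_deriv (zeta P i) z (v k)"
      using v(2)[of k] by (intro has_dir_deriv_eq has_dir_deriv_scale zeta_has_dir_deriv[OF Pz]) auto
    ultimately have "\<tau> k * dir_deriv (zeta P i) z (v k) \<le> zeta P i (z + \<tau> k *\<^sub>R v k) - zeta P i z"
      by simp
    then have "\<tau> k * dir_deriv (zeta P i) z (v k) + (phi P i (z + \<tau> k *\<^sub>R v k) - phi P i z)
      - (psi_max P i (z + \<tau> k *\<^sub>R v k) - psi_max P i z) \<le> 0"
      using k(2) iP(3) by (simp add: dc_fun_def)
    then have "(\<tau> k * dir_deriv (zeta P i) z (v k) + (phi P i (z + \<tau> k *\<^sub>R v k) - phi P i z)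
      - (psi_max P i (z + \<tau> k *\<^sub>R v k) - psi_max P i z)) / \<tau> k \<le> 0"
      using v(2)[of k] by (intro divide_nonpos_pos)
    then show ?thesis
      using v(2)[of k] by (simp add: add_divide_distrib diff_divide_distrib)
  qed
  ultimately show ?thesis
    by (intro tendsto_upperbound) auto
qed

lemma steepest_tuple_exists:
  fixes P :: "'a::euclidean_space dc_data"
  assumes "dc_program P"
  obtains js where "js \<in> active_tuples P z" "\<And>i. i \<in> {1..ncon P} \<Longrightarrow> js i \<in> steepest_pieces P i z d"
proof -
  have "(\<Pi>\<^sub>E i\<in>{1..ncon P}. steepest_pieces P i z d) \<noteq> {}"
    using dc_programD(5)[OF assms] steepest_pieces_nonempty[of P _ z d]
    by (auto simp: PiE_eq_empty_iff) (metis equals0D)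
  then obtain js where js: "js \<in> (\<Pi>\<^sub>E i\<in>{1..ncon P}. steepest_pieces P i z d)"
    by blast
  then have "js \<in> active_tuples P z"
    unfolding active_tuples_def by (rule PiE_mono[THEN subsetD, rotated]) (auto simp: steepest_pieces_def)
  with js show ?thesis
    by (intro that[of js]) auto
qed

section \<open>Limits of nearly model-optimal points\<close>

text \<open>The situation along a convergent subsequence: \<open>R\<close> are the penalty parameters, \<open>e\<close> the
  tolerances and \<open>u\<close> the iterates. Near-optimality refers to pieces active at the limit \<open>z\<close>, so that
  one choice of pieces serves for all late iterates.\<close>
locale penalty_limit =
  fixes P :: "'a::euclidean_space dc_data" and p :: real and R :: "nat \<Rightarrow> real"
    and e :: "nat \<Rightarrow> real" and u :: "nat \<Rightarrow> 'a" and z :: 'a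
  assumes P: "dc_program P" and p: "p \<ge> 1"
    and R_pos: "R k > 0" and R_lim: "filterlim R at_top sequentially"
    and e_lim: "e \<longlonglongrightarrow> 0"
    and u_mem: "u k \<in> ground P" and u_lim: "u \<longlonglongrightarrow> z"
    and near_min: "\<lbrakk>j0 \<in> active_pieces P 0 z; js \<in> active_tuples P z; y \<in> ground P\<rbrakk>
      \<Longrightarrow> \<forall>\<^sub>F k in sequentially. F_pen P p (R k) (u k) \<le> Q_pen P p (R k) (u k) j0 js y + e k"
begin

lemma z_mem: "z \<in> ground P" "z \<in> dom P"
proof -
  show "z \<in> ground P"
    using dc_programD(4)[OF P, of 0] u_mem u_lim closed_sequentially by blast
  then show "z \<in> dom P"
    using dc_programD(2)[OF P, of 0] by auto
qed

lemma tuple_piece: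
  assumes "js \<in> active_tuples P z" "i \<in> {1..ncon P}"
  shows "js i \<in> active_pieces P i z" "js i \<in> {1..npieces P i}" "i \<le> ncon P"
  using assms PiE_mem[of js "{1..ncon P}"] active_piecesD(1)[of "js i" P i z]
  by (auto simp: active_tuples_def)

text \<open>Divided by the penalty parameter, the objective terms and the tolerance vanish in the limit.\<close>
lemma penalty_le_model_penalty:
  assumes js: "js \<in> active_tuples P z" and y: "y \<in> ground P"
  shows "penalty_term P p z \<le> (\<Sum>i=1..ncon P. max (model P i (js i) z y) 0 powr p)"
proof -
  obtain j0 where j0: "j0 \<in> active_pieces P 0 z"
    using active_pieces_nonempty[OF dc_programD(5)[OF P, of 0]] by blast
  have "(\<lambda>k. penalty_term P p (u k)) \<longlonglongrightarrow> penalty_term P p z"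
    unfolding penalty_term_def using p
    by (intro tendsto_sum tendsto_powr2 tendsto_max dc_fun_tendsto[OF P _ z_mem(2) u_lim] tendsto_const) auto
  moreover have "(\<lambda>k. (\<Sum>i=1..ncon P. max (model P i (js i) (u k) y) 0 powr p)
      + (model P 0 j0 (u k) y - dc_fun P 0 (u k) + e k) / R k)
      \<longlonglongrightarrow> (\<Sum>i=1..ncon P. max (model P i (js i) z y) 0 powr p) + 0"
  proof (intro tendsto_add tendsto_sum tendsto_powr2 tendsto_max tendsto_const)
    show "(\<lambda>k. (model P 0 j0 (u k) y - dc_fun P 0 (u k) + e k) / R k) \<longlonglongrightarrow> 0"
      by (rule real_tendsto_divide_at_top[OF _ R_lim], rule tendsto_add[OF tendsto_diff e_lim],
          rule model_tendsto[OF P _ z_mem(2) active_piecesD(1)[OF j0] u_lim], simp,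
          rule dc_fun_tendsto[OF P _ z_mem(2) u_lim], simp)
    show "(\<lambda>k. model P i (js i) (u k) y) \<longlonglongrightarrow> model P i (js i) z y"
      if "i \<in> {1..ncon P}" for i
      using tuple_piece[OF js that] by (intro model_tendsto[OF P _ z_mem(2) _ u_lim])
  qed (use p in auto)
  moreover have "\<forall>\<^sub>F k in sequentially. penalty_term P p (u k)
      \<le> (\<Sum>i=1..ncon P. max (model P i (js i) (u k) y) 0 powr p)
        + (model P 0 j0 (u k) y - dc_fun P 0 (u k) + e k) / R k"
    using near_min[OF j0 js y]
  proof eventually_elim
    case (elim k)
    then show ?case
      using R_pos[of k] by (simp add: F_pen_def Q_pen_def field_simps)
  qed
  ultimately show ?thesis
    using tendsto_le[OF sequentially_bot] by fastforce
qed

text \<open>With the pieces steepest in direction \<open>y - z\<close>, penalty and model penalty share value and slope at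
  \<open>z\<close>, and the model penalty attains its minimum over the ground set there.\<close>
theorem penalty_D_stationary: "D_stationary (penalty_term P p) (ground P) z"
  unfolding D_stationary_def
proof (intro conjI ballI z_mem)
  fix y assume y: "y \<in> ground P"
  obtain js where js: "js \<in> active_tuples P z"
    "\<And>i. i \<in> {1..ncon P} \<Longrightarrow> js i \<in> steepest_pieces P i z (y - z)"
    using steepest_tuple_exists[OF P] by blast
  define D where "D = (\<Sum>i=1..ncon P. pos_powr_slope p (dc_fun P i z) (dir_model P i (js i) z (y - z)))"
  have "has_dir_deriv (penalty_term P p) z (y - z) D"
    unfolding penalty_term_def[abs_def] D_def
    by (intro has_dir_deriv_sum has_dir_deriv_pos_powr dc_fun_has_dir_deriv[OF P _ z_mem(2)] js p) auto
  moreover have "D \<ge> 0"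
  proof (rule has_dir_deriv_nonneg)
    let ?M = "\<lambda>y. \<Sum>i=1..ncon P. max (model P i (js i) z y) 0 powr p"
    have "has_dir_deriv ?M z (y - z) (\<Sum>i=1..ncon P. pos_powr_slope p (model P i (js i) z z) (dir_model P i (js i) z (y - z)))"
      by (intro has_dir_deriv_sum has_dir_deriv_pos_powr model_has_dir_deriv[OF P _ z_mem(2)] p) auto
    then show "has_dir_deriv ?M z (y - z) D"
      using tuple_piece(1)[OF js(1)] by (simp add: model_base_point D_def)
    have M_z: "?M z = penalty_term P p z"
      using tuple_piece(1)[OF js(1)] by (simp add: model_base_point penalty_term_def)
    show "\<forall>\<^sub>F t in at_right 0. ?M z \<le> ?M (z + t *\<^sub>R (y - z))"
      using convex_eventually_ray_mem[OF dc_programD(3)[OF P, of 0] z_mem(1) y, simplified]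
      by eventually_elim (unfold M_z, rule penalty_le_model_penalty[OF js(1)])
  qed
  ultimately show "\<exists>D. has_dir_deriv (penalty_term P p) z (y - z) D \<and> 0 \<le> D"
    by blast
qed

text \<open>The model penalty vanishes at \<open>y\<close>, while the true penalty is nonnegative and can be dropped; so
  the growing penalty parameter disappears from the inequality before the limit is taken.\<close>
lemma objective_le_model:
  assumes j0: "j0 \<in> active_pieces P 0 z" and js: "js \<in> active_tuples P z" and y: "y \<in> ground P"
    and le: "\<And>i. i \<in> {1..ncon P} \<Longrightarrow> \<forall>\<^sub>F k in sequentially. model P i (js i) (u k) y \<le> 0"
  shows "dc_fun P 0 z \<le> model P 0 j0 z y"
proof -
  have "\<forall>\<^sub>F k in sequentially. \<forall>i\<in>{1..ncon P}. model P i (js i) (u k) y \<le> 0"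
    using le by (intro eventually_ball_finite) auto
  with near_min[OF j0 js y]
  have "\<forall>\<^sub>F k in sequentially. dc_fun P 0 (u k) \<le> model P 0 j0 (u k) y + e k"
  proof eventually_elim
    case (elim k)
    have "0 \<le> R k * penalty_term P p (u k)"
      using R_pos[of k] by (auto simp: penalty_term_def intro!: mult_nonneg_nonneg sum_nonneg)
    moreover have "(\<Sum>i=1..ncon P. max (model P i (js i) (u k) y) 0 powr p) = 0"
      using elim(2) by (intro sum.neutral) (simp add: max_def)
    ultimately show ?case
      using elim(1) unfolding F_pen_def Q_pen_def by simp
  qed
  moreover have "(\<lambda>k. dc_fun P 0 (u k)) \<longlonglongrightarrow> dc_fun P 0 z"
    by (intro dc_fun_tendsto[OF P _ z_mem(2) u_lim]) auto
  moreover have "(\<lambda>k. model P 0 j0 (u k) y + e k) \<longlonglongrightarrow> model P 0 j0 z y + 0"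
    using active_piecesD(1)[OF j0]
    by (intro tendsto_add e_lim model_tendsto[OF P _ z_mem(2) _ u_lim]) auto
  ultimately show ?thesis
    using tendsto_le[OF sequentially_bot] by fastforce
qed

text \<open>The number of iterations after which the models are nonpositive may depend on the point of the
  ray, because the limit over the iterates is taken first, for each point separately.\<close>
lemma objective_slope_nonneg_on_ray:
  assumes j0: "j0 \<in> active_pieces P 0 z" and js: "js \<in> active_tuples P z"
    and ray: "\<forall>\<^sub>F t in at_right 0. z + t *\<^sub>R d \<in> ground P"
    and le: "\<And>i. i \<in> {1..ncon P} \<Longrightarrow>
      \<forall>\<^sub>F t in at_right 0. \<forall>\<^sub>F k in sequentially. model P i (js i) (u k) (z + t *\<^sub>R d) \<le> 0"
  shows "0 \<le> dir_model P 0 j0 z d"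
proof (rule has_dir_deriv_nonneg)
  show "has_dir_deriv (model P 0 j0 z) z d (dir_model P 0 j0 z d)"
    by (rule model_has_dir_deriv[OF P _ z_mem(2)]) simp
  have "\<forall>\<^sub>F t in at_right 0. \<forall>i\<in>{1..ncon P}.
      \<forall>\<^sub>F k in sequentially. model P i (js i) (u k) (z + t *\<^sub>R d) \<le> 0"
    using le by (intro eventually_ball_finite) auto
  with ray show "\<forall>\<^sub>F t in at_right 0. model P 0 j0 z z \<le> model P 0 j0 z (z + t *\<^sub>R d)"
    by eventually_elim (use objective_le_model[OF j0 js] j0 in \<open>simp add: model_base_point\<close>)
qed

lemma model_nonpos_on_ray:
  assumes js: "js \<in> active_tuples P z" and i: "i \<in> {1..ncon P}"
    and neg: "dc_fun P i z < 0 \<or> dc_fun P i z = 0 \<and> dir_model P i (js i) z d < 0"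
  shows "\<forall>\<^sub>F t in at_right 0. \<forall>\<^sub>F k in sequentially. model P i (js i) (u k) (z + t *\<^sub>R d) \<le> 0"
proof -
  note piece = tuple_piece[OF js i]
  have D: "has_dir_deriv (model P i (js i) z) z d (dir_model P i (js i) z d)"
    by (rule model_has_dir_deriv[OF P piece(3) z_mem(2)])
  have "\<forall>\<^sub>F t in at_right 0. model P i (js i) z (z + t *\<^sub>R d) < 0"
    using neg
  proof
    assume "dc_fun P i z < 0"
    then show ?thesis
      using has_dir_deriv_tendsto[OF D] model_base_point[OF piece(1)] order_tendstoD(2) by fastforce
  next
    assume "dc_fun P i z = 0 \<and> dir_model P i (js i) z d < 0"
    then show ?thesis
      using has_dir_deriv_neg[OF D] model_base_point[OF piece(1)] by simp
  qed
  then show ?thesis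
  proof eventually_elim
    case (elim t)
    have "\<forall>\<^sub>F k in sequentially. model P i (js i) (u k) (z + t *\<^sub>R d) < 0"
      using elim by (rule order_tendstoD(2)[OF model_tendsto[OF P piece(3) z_mem(2) piece(2) u_lim]])
    then show ?case
      by (rule eventually_mono) simp
  qed
qed

text \<open>Negative slopes are an open condition on the direction, so \<open>d\<close> may be approximated by multiples
  of differences \<open>y - z\<close>, along which the ground set contains a segment.\<close>
lemma objective_slope_nonneg_if_strict:
  assumes j0: "j0 \<in> active_pieces P 0 z" and js: "js \<in> active_tuples P z" and z: "z \<in> feasible P"
    and d: "d \<in> closure (cone hull ((\<lambda>y. y - z) ` ground P))"
    and neg: "\<And>i. i \<in> active_constraints P z \<Longrightarrow> dir_model P i (js i) z d < 0"
  shows "0 \<le> dir_model P 0 j0 z d"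
proof -
  obtain v where v: "\<And>k. v k \<in> cone hull ((\<lambda>y. y - z) ` ground P)" "v \<longlonglongrightarrow> d"
    using d unfolding closure_sequential by blast
  have "\<forall>\<^sub>F k in sequentially. dir_model P i (js i) z (v k) < 0" if "i \<in> active_constraints P z" for i
    using that neg[OF that]
    by (intro order_tendstoD(2)[OF dir_model_tendsto[OF P _ z_mem(2) v(2)]]) (auto simp: active_constraints_def)
  then have "\<forall>\<^sub>F k in sequentially. \<forall>i\<in>active_constraints P z. dir_model P i (js i) z (v k) < 0"
    by (intro eventually_ball_finite) (auto simp: active_constraints_def)
  then have "\<forall>\<^sub>F k in sequentially. 0 \<le> dir_model P 0 j0 z (v k)"
  proof eventually_elim
    case (elim k)
    obtain c y where cy: "v k = c *\<^sub>R (y - z)" "c \<ge> 0" "y \<in> ground P"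
      using v(1)[of k] unfolding cone_hull_expl by blast
    \<comment> \<open>For \<open>c = 0\<close> the constraint slopes say nothing about \<open>y\<close>, but then the slope along
      \<open>v k = 0\<close> vanishes.\<close>
    have "0 \<le> dir_model P 0 j0 z (y - z)" if "c > 0"
    proof (rule objective_slope_nonneg_on_ray[OF j0 js])
      show "\<forall>\<^sub>F t in at_right 0. z + t *\<^sub>R (y - z) \<in> ground P"
        using convex_eventually_ray_mem[OF dc_programD(3)[OF P, of 0] z_mem(1) cy(3)] by simp
      fix i assume i: "i \<in> {1..ncon P}"
      have "dir_model P i (js i) z (y - z) < 0" if "dc_fun P i z = 0"
        using elim that i \<open>c > 0\<close> dir_model_scale[OF P _ z_mem(2) cy(2), of i "js i" "y - z"]
        by (auto simp: active_constraints_def cy(1) mult_less_0_iff)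
      with z i show "\<forall>\<^sub>F t in at_right 0. \<forall>\<^sub>F k in sequentially.
          model P i (js i) (u k) (z + t *\<^sub>R (y - z)) \<le> 0"
        by (intro model_nonpos_on_ray[OF js i]) (force simp: feasible_def)
    qed
    then have "0 \<le> c * dir_model P 0 j0 z (y - z)"
      using cy(2) by (cases "c = 0") auto
    then show ?case
      by (simp add: cy(1) dir_model_scale[OF P _ z_mem(2) cy(2)])
  qed
  moreover have "(\<lambda>k. dir_model P 0 j0 z (v k)) \<longlonglongrightarrow> dir_model P 0 j0 z d"
    by (intro dir_model_tendsto[OF P _ z_mem(2) v(2)]) simp
  ultimately show ?thesis
    by (intro tendsto_lowerbound) auto
qed

text \<open>The slope of the objective is that of its model for the piece steepest along \<open>d\<close>, one of the
  active pieces.\<close>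
lemma objective_dir_deriv_nonneg:
  assumes "\<And>j0. j0 \<in> active_pieces P 0 z \<Longrightarrow> 0 \<le> dir_model P 0 j0 z d"
  shows "\<exists>D. has_dir_deriv (dc_fun P 0) z d D \<and> D \<ge> 0"
proof -
  obtain j0 where j0: "j0 \<in> steepest_pieces P 0 z d"
    using steepest_pieces_nonempty[OF dc_programD(5)[OF P, of 0]] by blast
  then have "0 \<le> dir_model P 0 j0 z d"
    by (intro assms) (simp add: steepest_pieces_def)
  with dc_fun_has_dir_deriv[OF P _ z_mem(2) j0] show ?thesis
    by auto
qed

theorem unconstrained_D_stationary:
  assumes z: "z \<in> feasible P" and inactive: "active_constraints P z = {}"
  shows "D_stationary (dc_fun P 0) (ground P) z"
  unfolding D_stationary_def
proof (intro conjI ballI z_mem objective_dir_deriv_nonneg)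
  fix y j0 assume y: "y \<in> ground P" and j0: "j0 \<in> active_pieces P 0 z"
  obtain js where js: "js \<in> active_tuples P z"
    using steepest_tuple_exists[OF P] by blast
  have "y - z \<in> cone hull ((\<lambda>y. y - z) ` ground P)"
    using y by (intro hull_inc) auto
  then show "0 \<le> dir_model P 0 j0 z (y - z)"
    using inactive closure_subset by (intro objective_slope_nonneg_if_strict[OF j0 js z]) auto
qed

theorem PSCQ_B_stationary:
  assumes z: "z \<in> feasible P" and PSCQ: "PSCQ P z"
  shows "B_stationary (dc_fun P 0) (feasible P) z"
  unfolding B_stationary_def
proof (intro conjI ballI z objective_dir_deriv_nonneg)
  fix d j0 assume d: "d \<in> tangent_cone (feasible P) z" and j0: "j0 \<in> active_pieces P 0 z"
  obtain js where js: "js \<in> active_tuples P z"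
    "\<And>i. i \<in> {1..ncon P} \<Longrightarrow> js i \<in> steepest_pieces P i z d"
    using steepest_tuple_exists[OF P] by blast
  obtain s where s: "s \<in> tangent_cone (ground P) z"
    "\<And>i. i \<in> active_constraints P z \<Longrightarrow> dir_model P i (js i) z s < 0"
    using PSCQ js(1) unfolding PSCQ_def dir_model_def by blast
  let ?K = "closure (cone hull ((\<lambda>y. y - z) ` ground P))"
  have "feasible P \<subseteq> ground P"
    by (auto simp: feasible_def)
  then have K: "d \<in> ?K" "s \<in> ?K"
    using d s(1) tangent_cone_mono tangent_cone_subset_closure by blast+
  \<comment> \<open>The direction tilted by \<open>t\<close> towards the Slater direction has negative constraint slopes.\<close>
  have "\<forall>\<^sub>F t in at_right 0. 0 \<le> dir_model P 0 j0 z ((1 - t) *\<^sub>R d + t *\<^sub>R s)"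
    using eventually_at_right_real[of 0 "1::real", OF zero_less_one]
  proof eventually_elim
    case (elim t)
    show ?case
    proof (rule objective_slope_nonneg_if_strict[OF j0 js(1) z])
      show "(1 - t) *\<^sub>R d + t *\<^sub>R s \<in> ?K"
        using convex_closure_feasible_directions[OF dc_programD(3)[OF P, of 0]] K elim
        by (intro convexD) auto
      fix i assume i: "i \<in> active_constraints P z"
      then have iP: "i \<in> {1..ncon P}" "i \<le> ncon P"
        by (auto simp: active_constraints_def)
      have "dir_model P i (js i) z ((1 - t) *\<^sub>R d + t *\<^sub>R s)
          \<le> (1 - t) * dir_model P i (js i) z d + t * dir_model P i (js i) z s"
        using convex_onD[OF convex_on_dir_model[OF P iP(2) z_mem(2)]] elim by simp
      also have "\<dots> < 0"
      proof (rule add_nonpos_neg)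
        show "(1 - t) * dir_model P i (js i) z d \<le> 0"
          using tangent_cone_feasible_dir_model[OF P z_mem(2) i d js(2)[OF iP(1)]] elim
          by (intro mult_nonneg_nonpos) auto
        show "t * dir_model P i (js i) z s < 0"
          using s(2)[OF i] elim by (intro mult_pos_neg) auto
      qed
      finally show "dir_model P i (js i) z ((1 - t) *\<^sub>R d + t *\<^sub>R s) < 0" .
    qed
  qed
  moreover have "((\<lambda>t. (1 - t) *\<^sub>R d + t *\<^sub>R s) \<longlongrightarrow> (1 - 0) *\<^sub>R d + 0 *\<^sub>R s) (at_right (0::real))"
    by (intro tendsto_intros tendsto_ident_at)
  then have "((\<lambda>t. dir_model P 0 j0 z ((1 - t) *\<^sub>R d + t *\<^sub>R s)) \<longlongrightarrow> dir_model P 0 j0 z d) (at_right (0::real))"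
    by (intro dir_model_tendsto[OF P _ z_mem(2)]) auto
  ultimately show "0 \<le> dir_model P 0 j0 z d"
    by (intro tendsto_lowerbound) auto
qed

theorem polyhedral_B_stationary:
  assumes z: "z \<in> feasible P" and X: "polyhedron (ground P)"
    and affine: "\<And>i j. \<lbrakk>i \<in> active_constraints P z; j \<in> active_pieces P i z\<rbrakk> \<Longrightarrow>
      affine_fun_on (ground P) (phi P i) \<and> affine_fun_on (ground P) (psi P i j) \<and>
      piecewise_affine_on (ground P) (zeta P i)"
  shows "B_stationary (dc_fun P 0) (feasible P) z"
  unfolding B_stationary_def
proof (intro conjI ballI z objective_dir_deriv_nonneg)
  fix d j0 assume d: "d \<in> tangent_cone (feasible P) z" and j0: "j0 \<in> active_pieces P 0 z"
  obtain js where js: "js \<in> active_tuples P z"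
    "\<And>i. i \<in> {1..ncon P} \<Longrightarrow> js i \<in> steepest_pieces P i z d"
    using steepest_tuple_exists[OF P] by blast
  have "feasible P \<subseteq> ground P"
    by (auto simp: feasible_def)
  then have ray: "\<forall>\<^sub>F t in at_right 0. z + t *\<^sub>R d \<in> ground P"
    using d tangent_cone_mono by (intro polyhedron_tangent_ray[OF X z_mem(1)]) blast
  show "0 \<le> dir_model P 0 j0 z d"
  proof (rule objective_slope_nonneg_on_ray[OF j0 js(1) ray])
    fix i assume i: "i \<in> {1..ncon P}"
    note piece = tuple_piece[OF js(1) i]
    show "\<forall>\<^sub>F t in at_right 0. \<forall>\<^sub>F k in sequentially. model P i (js i) (u k) (z + t *\<^sub>R d) \<le> 0"
    proof (cases "i \<in> active_constraints P z")
      case False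
      with z i show ?thesis
        by (intro model_nonpos_on_ray[OF js(1) i]) (force simp: feasible_def active_constraints_def)
    next
      case True
      note aff = affine[OF True piece(1)]
      have lip: "lip P i = 0"
        using P i aff by (auto simp: dc_program_def)
      have diff: "phi P i differentiable (at x)" "psi P i (js i) differentiable (at x)"
        if "x \<in> ground P" for x
        using dc_programD(2,9,10)[OF P piece(3)] piece(2) that by (auto simp: C1_on_def)
      \<comment> \<open>Affine functions equal their linearizations and the quadratic term has coefficient zero,
        so every base point gives the same model and nothing changes along the iterates.\<close>
      have indep: "model P i (js i) x y = phi P i y + zeta P i y - psi P i (js i) y"
        if "x \<in> ground P" "y \<in> ground P" for x y
      proof -
        have "linearization (phi P i) x y = phi P i y"
          "linearization (psi P i (js i)) x y = psi P i (js i) y"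
          using aff diff that dc_programD(3)[OF P piece(3)]
          by (auto intro!: affine_linearization[where X = "ground P"])
        then show ?thesis
          by (simp add: model_def phi_hat_def lip)
      qed
      obtain s where s: "\<forall>\<^sub>F t in at_right 0. zeta P i (z + t *\<^sub>R d) = zeta P i z + t * s"
        using piecewise_affine_ray[OF _ ray] aff by blast
      have "has_dir_deriv (zeta P i) z d s"
        unfolding has_dir_deriv_def
        by (rule Lim_transform_eventually[OF tendsto_const])
           (use s eventually_at_right_less[of "0::real"] in eventually_elim, simp)
      then have s_eq: "s = dir_deriv (zeta P i) z d"
        by (simp add: has_dir_deriv_eq)
      have le: "dir_model P i (js i) z d \<le> 0"
        by (rule tangent_cone_feasible_dir_model[OF P z_mem(2) True d js(2)[OF i]])
      show ?thesis
        using s ray eventually_at_right_less[of "0::real"]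
      proof eventually_elim
        case (elim t)
        have "model P i (js i) (u k) (z + t *\<^sub>R d) \<le> 0" for k
        proof -
          have "model P i (js i) (u k) (z + t *\<^sub>R d) = model P i (js i) z (z + t *\<^sub>R d)"
            using elim by (simp add: indep u_mem z_mem)
          also have "\<dots> = model P i (js i) z z + t * dir_model P i (js i) z d"
            using elim by (simp add: model_def phi_hat_def lip linearization_def dir_model_def s_eq algebra_simps)
          also have "\<dots> = t * dir_model P i (js i) z d"
            using True by (simp add: model_base_point[OF piece(1)] active_constraints_def)
          also have "\<dots> \<le> 0"
            using elim le by (intro mult_nonneg_nonpos) auto
          finally show ?thesis .
        qed
        then show ?case by simp
      qed
    qed
  qed
qed

end

section \<open>The penalty method\<close>

text \<open>The gap between the maximum and a piece is continuous and vanishes at \<open>z\<close> for an active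
  piece, so near \<open>z\<close> it is below \<open>\<epsilon>\<close>.\<close>
lemma eventually_eps_active:
  assumes P: "dc_program P" "i \<le> ncon P" "z \<in> dom P" and u: "(u \<longlongrightarrow> z) F" and "\<epsilon> > 0"
    and j: "j \<in> active_pieces P i z"
  shows "\<forall>\<^sub>F k in F. j \<in> eps_active_pieces P \<epsilon> i (u k)"
proof -
  have "((\<lambda>k. psi_max P i (u k) - psi P i j (u k)) \<longlongrightarrow> psi_max P i z - psi P i j z) F"
    using active_piecesD(1)[OF j]
    by (intro tendsto_diff psi_max_tendsto[OF P u] C1_on_tendsto[OF dc_programD(10)[OF P(1,2)] P(3) u])
  then have "\<forall>\<^sub>F k in F. psi_max P i (u k) - psi P i j (u k) < \<epsilon>"
    using active_piecesD(2)[OF j] \<open>\<epsilon> > 0\<close> by (intro order_tendstoD) auto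
  then show ?thesis
    by (rule eventually_mono) (use active_piecesD(1)[OF j] in \<open>auto simp: eps_active_pieces_def\<close>)
qed

lemma penalty_iterates_imp_penalty_limit:
  fixes P :: "'a::euclidean_space dc_data"
  assumes P: "dc_program P" and p: "p \<ge> 1" and "\<epsilon> > 0" "\<rho>\<^sub>0 > 0" "\<sigma> > 1" and \<eta>: "\<eta> \<longlonglongrightarrow> 0"
    and it: "penalty_iterates P p \<epsilon> \<rho>\<^sub>0 \<sigma> \<eta> x" and r: "strict_mono r" and lim: "(x \<circ> r) \<longlonglongrightarrow> z"
  shows "penalty_limit P p (\<lambda>k. \<rho>\<^sub>0 * \<sigma> ^ r k) (\<eta> \<circ> r) (x \<circ> r) z"
proof -
  obtain \<rho> where \<rho>: "\<rho> 0 = \<rho>\<^sub>0" "\<And>k. \<rho> (Suc k) = \<sigma> * \<rho> k"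
    and x: "\<And>k. x k \<in> ground P"
    and min: "\<And>k j0 js y. \<lbrakk>j0 \<in> eps_active_pieces P \<epsilon> 0 (x k); js \<in> eps_active_tuples P \<epsilon> (x k);
      y \<in> ground P\<rbrakk> \<Longrightarrow> F_pen P p (\<rho> k) (x k) \<le> Q_pen P p (\<rho> k) (x k) j0 js y + \<eta> k"
    using it unfolding penalty_iterates_def by blast
  have \<rho>_eq: "\<rho> k = \<rho>\<^sub>0 * \<sigma> ^ k" for k
    by (induction k) (simp_all add: \<rho>)
  have z: "z \<in> dom P"
    using dc_programD(2,4)[OF P, of 0] x lim closed_sequentially[of "ground P" "x \<circ> r" z] by auto
  show ?thesis
  proof
    show "\<rho>\<^sub>0 * \<sigma> ^ r k > 0" for k
      using assms by simp
    have "filterlim (\<lambda>k. \<sigma> ^ k) at_top sequentially"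
      using \<open>\<sigma> > 1\<close>
      by (intro filterlim_at_infinity_imp_filterlim_at_top filterlim_realpow_sequentially_gt1) auto
    then have "filterlim (\<lambda>k. \<sigma> ^ r k) at_top sequentially"
      using filterlim_subseq[OF r] by (rule filterlim_compose)
    then show "filterlim (\<lambda>k. \<rho>\<^sub>0 * \<sigma> ^ r k) at_top sequentially"
      using \<open>\<rho>\<^sub>0 > 0\<close> by (intro filterlim_tendsto_pos_mult_at_top[OF tendsto_const])
    show "(\<eta> \<circ> r) \<longlonglongrightarrow> 0"
      using \<eta> r by (rule LIMSEQ_subseq_LIMSEQ)
    show "(x \<circ> r) k \<in> ground P" for k
      using x by simp
    fix j0 js y
    assume j0: "j0 \<in> active_pieces P 0 z" and js: "js \<in> active_tuples P z" and y: "y \<in> ground P"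
    note ev = eventually_eps_active[OF P _ z lim \<open>\<epsilon> > 0\<close>]
    have "\<forall>\<^sub>F k in sequentially. \<forall>i\<in>{1..ncon P}. js i \<in> eps_active_pieces P \<epsilon> i ((x \<circ> r) k)"
      using js by (intro eventually_ball_finite ballI ev) (auto simp: active_tuples_def)
    moreover have "\<forall>\<^sub>F k in sequentially. j0 \<in> eps_active_pieces P \<epsilon> 0 ((x \<circ> r) k)"
      using j0 by (intro ev) auto
    ultimately show "\<forall>\<^sub>F k in sequentially. F_pen P p (\<rho>\<^sub>0 * \<sigma> ^ r k) ((x \<circ> r) k)
        \<le> Q_pen P p (\<rho>\<^sub>0 * \<sigma> ^ r k) ((x \<circ> r) k) j0 js y + (\<eta> \<circ> r) k"
    proof eventually_elim
      case (elim k)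
      then have "js \<in> eps_active_tuples P \<epsilon> (x (r k))"
        using js by (auto simp: eps_active_tuples_def active_tuples_def PiE_iff)
      with elim y show ?case
        using min[of j0 "r k" js y] by (simp add: \<rho>_eq)
    qed
  qed (use P p lim in auto)
qed

theorem theorem3p1:
  fixes P :: "(real ^ 'n) dc_data"
    and p \<epsilon> \<rho>\<^sub>0 \<sigma> :: real
    and \<eta> :: "nat \<Rightarrow> real"
    and x :: "nat \<Rightarrow> real ^ 'n"
    and x_inf :: "real ^ 'n"
    and r :: "nat \<Rightarrow> nat"
  assumes "dc_program P"
    and "p \<ge> 1"
    and "\<epsilon> > 0" and "\<rho>\<^sub>0 > 0" and "\<sigma> > 1"
    and "\<And>k. \<eta> k \<ge> 0" and "\<eta> \<longlonglongrightarrow> 0"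
    and "penalty_iterates P p \<epsilon> \<rho>\<^sub>0 \<sigma> \<eta> x"
    and "strict_mono r" and "(x \<circ> r) \<longlonglongrightarrow> x_inf"
  shows "D_stationary (penalty_term P p) (ground P) x_inf
    \<and> (x_inf \<in> feasible P \<and> active_constraints P x_inf = {} \<longrightarrow>
           D_stationary (dc_fun P 0) (ground P) x_inf)
    \<and> (x_inf \<in> feasible P \<and> active_constraints P x_inf \<noteq> {} \<and> PSCQ P x_inf \<longrightarrow>
           B_stationary (dc_fun P 0) (feasible P) x_inf)
    \<and> (x_inf \<in> feasible P \<and> active_constraints P x_inf \<noteq> {} \<and> polyhedron (ground P) \<and>
         (\<forall>i\<in>active_constraints P x_inf. \<forall>j\<in>active_pieces P i x_inf.
            affine_fun_on (ground P) (phi P i) \<and> affine_fun_on (ground P) (psi P i j) \<and>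
            piecewise_affine_on (ground P) (zeta P i)) \<longrightarrow>
           B_stationary (dc_fun P 0) (feasible P) x_inf)"
proof -
  interpret penalty_limit P p "\<lambda>k. \<rho>\<^sub>0 * \<sigma> ^ r k" "\<eta> \<circ> r" "x \<circ> r" x_inf
    by (rule penalty_iterates_imp_penalty_limit) (use assms in auto)
  show ?thesis
    using penalty_D_stationary unconstrained_D_stationary PSCQ_B_stationary polyhedral_B_stationary
    by blast
qed

end
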